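(* Let $P(X)=\sum_{i=0}^{m} A_i X^i$ be a polynomial whose coefficients $A_0,\dots,A_m$ are finite discrete dynamical systems (FDDSs). Then $P$ is injective on FDDSs (i.e., for all FDDSs $X,Y$, $P(X)=P(Y)$ implies $X=Y$) if and only if at least one coefficient $A_i$ with $i>0$ contains a dendron as a connected component.
   Context: An FDDS is a pair $(A,f_A)$ with $A$ a finite set of states and $f_A\colon A\to A$ a total function, viewed as a functional digraph and considered up to isomorphism. The sum of two FDDSs is their disjoint union and the product is the direct (tensor) product of digraphs: vertex set $V(A)\times V(B)$ and an arc $(u,u')\to(v,v')$ iff $u\to v$ in $A$ and $u'\to v'$ in $B$. These operations make FDDSs a commutative semiring, with $\mathbf{0}$ the empty FDDS and $\mathbf{1}$ the single fixed point; $X^0=\mathbf{1}$. Every connected component of an FDDS consists of one cycle with in-trees rooted on it. A dendron is a connected FDDS whose cycle has length $1$. An FDDS $A$ "contains" a connected FDDS $D$ if $D$ is one of its connected components. *)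

theory Defs
  imports Main "HOL-Library.Nat_Bijection"
begin

text \<open>
  A system is a pair of a carrier and a map. The map is a total HOL function; only its values on
  the carrier matter, since everything below is considered up to \<open>sys_iso\<close>.
\<close>

type_synonym 'a sys = "'a set \<times> ('a \<Rightarrow> 'a)"

definition is_fdds :: "'a sys \<Rightarrow> bool" where
  "is_fdds S \<longleftrightarrow> finite (fst S) \<and> (\<forall>x\<in>fst S. snd S x \<in> fst S)"

definition sys_iso :: "'a sys \<Rightarrow> 'b sys \<Rightarrow> bool" where
  "sys_iso S T \<longleftrightarrow>
     (\<exists>h. bij_betw h (fst S) (fst T) \<and> (\<forall>x\<in>fst S. h (snd S x) = snd T (h x)))"

definition sys_arcs :: "'a sys \<Rightarrow> 'a rel" where
  "sys_arcs S = {(x, snd S x) | x. x \<in> fst S}"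

definition sys_sum :: "'a sys \<Rightarrow> 'b sys \<Rightarrow> ('a + 'b) sys" where
  "sys_sum S T = (fst S <+> fst T, map_sum (snd S) (snd T))"

definition sys_prod :: "'a sys \<Rightarrow> 'b sys \<Rightarrow> ('a \<times> 'b) sys" where
  "sys_prod S T = (fst S \<times> fst T, map_prod (snd S) (snd T))"

lemma sys_arcs_prod:
  "((u, u'), (v, v')) \<in> sys_arcs (sys_prod S T) \<longleftrightarrow>
     (u, v) \<in> sys_arcs S \<and> (u', v') \<in> sys_arcs T"
  by (auto simp: sys_arcs_def sys_prod_def)

definition weakly_connected_rel :: "'a sys \<Rightarrow> 'a rel" where
  "weakly_connected_rel S = (sys_arcs S \<union> (sys_arcs S)\<inverse>)\<^sup>* \<inter> fst S \<times> fst S"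

definition sys_connected :: "'a sys \<Rightarrow> bool" where
  "sys_connected S \<longleftrightarrow> fst S \<noteq> {} \<and> weakly_connected_rel S = fst S \<times> fst S"

definition sys_components :: "'a sys \<Rightarrow> 'a sys set" where
  "sys_components S = (\<lambda>C. (C, snd S)) ` (fst S // weakly_connected_rel S)"

definition sys_contains :: "'a sys \<Rightarrow> 'b sys \<Rightarrow> bool" where
  "sys_contains S D \<longleftrightarrow> (\<exists>C\<in>sys_components S. sys_iso C D)"

definition cyclic_states :: "'a sys \<Rightarrow> 'a set" where
  "cyclic_states S = {x \<in> fst S. \<exists>k>0. (snd S ^^ k) x = x}"

text \<open>
  A connected system has exactly one cycle, consisting of its cyclic states, so the number of
  cyclic states is the length of that cycle.
\<close>

definition sys_dendron :: "'a sys \<Rightarrow> bool" where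
  "sys_dendron S \<longleftrightarrow> sys_connected S \<and> card (cyclic_states S) = 1"

lemma sys_isoI:
  "bij_betw h (fst S) (fst T) \<Longrightarrow> (\<And>x. x \<in> fst S \<Longrightarrow> h (snd S x) = snd T (h x)) \<Longrightarrow> sys_iso S T"
  unfolding sys_iso_def by blast

lemma sys_iso_refl [simp]: "sys_iso S S"
  by (rule sys_isoI[of id]) auto

lemma sys_iso_sym:
  assumes "sys_iso S T" "is_fdds S"
  shows "sys_iso T S"
proof -
  obtain h where h: "bij_betw h (fst S) (fst T)"
    "\<And>x. x \<in> fst S \<Longrightarrow> h (snd S x) = snd T (h x)"
    using assms(1) unfolding sys_iso_def by blast
  show ?thesis
  proof (rule sys_isoI)
    show "bij_betw (inv_into (fst S) h) (fst T) (fst S)"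
      using h(1) by (rule bij_betw_inv_into)
    fix y assume "y \<in> fst T"
    then obtain x where x: "x \<in> fst S" "y = h x"
      using h(1) by (auto simp: bij_betw_def)
    have "snd S x \<in> fst S" using assms(2) x by (auto simp: is_fdds_def)
    then show "inv_into (fst S) h (snd T y) = snd S (inv_into (fst S) h y)"
      using x h by (metis bij_betw_inv_into_left)
  qed
qed

lemma sys_iso_trans:
  assumes "sys_iso S T" "sys_iso T U"
  shows "sys_iso S U"
proof -
  obtain h where h: "bij_betw h (fst S) (fst T)"
    "\<And>x. x \<in> fst S \<Longrightarrow> h (snd S x) = snd T (h x)"
    using assms(1) unfolding sys_iso_def by blast
  obtain k where k: "bij_betw k (fst T) (fst U)"
    "\<And>x. x \<in> fst T \<Longrightarrow> k (snd T x) = snd U (k x)"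
    using assms(2) unfolding sys_iso_def by blast
  show ?thesis
  proof (rule sys_isoI)
    show "bij_betw (k \<circ> h) (fst S) (fst U)" using h(1) k(1) by (rule bij_betw_trans)
  qed (use h k in \<open>auto simp: bij_betw_def\<close>)
qed

lemma is_fdds_sum: "is_fdds S \<Longrightarrow> is_fdds T \<Longrightarrow> is_fdds (sys_sum S T)"
  by (auto simp: is_fdds_def sys_sum_def)

lemma is_fdds_prod: "is_fdds S \<Longrightarrow> is_fdds T \<Longrightarrow> is_fdds (sys_prod S T)"
  by (auto simp: is_fdds_def sys_prod_def)

lemma sys_iso_sum:
  assumes "sys_iso S S'" "sys_iso T T'"
  shows "sys_iso (sys_sum S T) (sys_sum S' T')"
proof -
  obtain h where h: "bij_betw h (fst S) (fst S')"
    "\<And>x. x \<in> fst S \<Longrightarrow> h (snd S x) = snd S' (h x)"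
    using assms(1) unfolding sys_iso_def by blast
  obtain k where k: "bij_betw k (fst T) (fst T')"
    "\<And>x. x \<in> fst T \<Longrightarrow> k (snd T x) = snd T' (k x)"
    using assms(2) unfolding sys_iso_def by blast
  show ?thesis
  proof (rule sys_isoI)
    have "inj_on (map_sum h k) (fst S <+> fst T)"
      using h(1) k(1) by (auto simp: bij_betw_def intro!: inj_onI dest: inj_onD)
    moreover have "map_sum h k ` (fst S <+> fst T) = (h ` fst S) <+> (k ` fst T)"
      by (simp add: Plus_def image_Un image_image)
    ultimately show "bij_betw (map_sum h k) (fst (sys_sum S T)) (fst (sys_sum S' T'))"
      using h(1) k(1) by (simp add: sys_sum_def bij_betw_def)
  qed (use h(2) k(2) in \<open>auto simp: sys_sum_def\<close>)
qed

lemma sys_iso_prod: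
  assumes "sys_iso S S'" "sys_iso T T'"
  shows "sys_iso (sys_prod S T) (sys_prod S' T')"
proof -
  obtain h where h: "bij_betw h (fst S) (fst S')"
    "\<And>x. x \<in> fst S \<Longrightarrow> h (snd S x) = snd S' (h x)"
    using assms(1) unfolding sys_iso_def by blast
  obtain k where k: "bij_betw k (fst T) (fst T')"
    "\<And>x. x \<in> fst T \<Longrightarrow> k (snd T x) = snd T' (k x)"
    using assms(2) unfolding sys_iso_def by blast
  show ?thesis
  proof (rule sys_isoI)
    show "bij_betw (map_prod h k) (fst (sys_prod S T)) (fst (sys_prod S' T'))"
      using h(1) k(1) by (simp add: sys_prod_def bij_betw_map_prod)
  qed (use h(2) k(2) in \<open>auto simp: sys_prod_def\<close>)
qed

lemma funpow_iso:
  assumes "is_fdds S" "\<And>x. x \<in> fst S \<Longrightarrow> h (snd S x) = snd T (h x)" "x \<in> fst S"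
  shows "h ((snd S ^^ k) x) = (snd T ^^ k) (h x) \<and> (snd S ^^ k) x \<in> fst S"
proof (induction k)
  case (Suc k)
  then show ?case using assms(1) assms(2)[of "(snd S ^^ k) x"] by (simp add: is_fdds_def)
qed (simp add: assms(3))

lemma weakly_connected_rel_iso:
  assumes "is_fdds S" "\<And>x. x \<in> fst S \<Longrightarrow> h (snd S x) = snd T (h x)"
    and "h ` fst S \<subseteq> fst T" "(x, y) \<in> weakly_connected_rel S"
  shows "(h x, h y) \<in> weakly_connected_rel T"
proof -
  have xy: "x \<in> fst S" "y \<in> fst S" "(x, y) \<in> (sys_arcs S \<union> (sys_arcs S)\<inverse>)\<^sup>*"
    using assms(4) by (auto simp: weakly_connected_rel_def)
  from xy(3) have "(h x, h y) \<in> (sys_arcs T \<union> (sys_arcs T)\<inverse>)\<^sup>*"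
  proof induction
    case (step y z)
    then have "(h y, h z) \<in> sys_arcs T \<union> (sys_arcs T)\<inverse>"
      using assms(2,3) unfolding sys_arcs_def by fastforce
    then show ?case using step.IH by (rule rtrancl_into_rtrancl[rotated])
  qed simp
  then show ?thesis using xy assms(3) by (auto simp: weakly_connected_rel_def)
qed

lemma weakly_connected_rel_iso_iff:
  assumes "is_fdds S" "is_fdds T" "bij_betw h (fst S) (fst T)"
    and "\<And>x. x \<in> fst S \<Longrightarrow> h (snd S x) = snd T (h x)" and xy: "x \<in> fst S" "y \<in> fst S"
  shows "(h x, h y) \<in> weakly_connected_rel T \<longleftrightarrow> (x, y) \<in> weakly_connected_rel S"
proof
  assume "(x, y) \<in> weakly_connected_rel S"
  then show "(h x, h y) \<in> weakly_connected_rel T"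
    using assms by (intro weakly_connected_rel_iso[of S h T]) (auto simp: bij_betw_def)
next
  let ?k = "inv_into (fst S) h"
  assume *: "(h x, h y) \<in> weakly_connected_rel T"
  have "(?k (h x), ?k (h y)) \<in> weakly_connected_rel S"
  proof (rule weakly_connected_rel_iso[OF assms(2) _ _ *])
    show "?k ` fst T \<subseteq> fst S"
      using bij_betw_inv_into[OF assms(3)] by (auto simp: bij_betw_def)
    fix z assume "z \<in> fst T"
    then obtain w where w: "w \<in> fst S" "z = h w"
      using assms(3) by (auto simp: bij_betw_def)
    have "snd S w \<in> fst S" using assms(1) w by (auto simp: is_fdds_def)
    then show "?k (snd T z) = snd S (?k z)"
      using w assms(3,4) by (metis bij_betw_inv_into_left)
  qed
  then show "(x, y) \<in> weakly_connected_rel S"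
    using xy assms(3) by (simp add: bij_betw_inv_into_left)
qed

lemma sys_contains_iso:
  assumes "is_fdds S" "is_fdds S'" "sys_iso S S'" "sys_iso D D'" "sys_contains S D"
  shows "sys_contains S' D'"
proof -
  obtain h where h: "bij_betw h (fst S) (fst S')"
    "\<And>x. x \<in> fst S \<Longrightarrow> h (snd S x) = snd S' (h x)"
    using assms(3) unfolding sys_iso_def by blast
  have iff: "(h u, h v) \<in> weakly_connected_rel S' \<longleftrightarrow> (u, v) \<in> weakly_connected_rel S"
    if "u \<in> fst S" "v \<in> fst S" for u v
    using assms(1,2) h that by (rule weakly_connected_rel_iso_iff)
  obtain x where x: "x \<in> fst S"
    and C: "sys_iso (weakly_connected_rel S `` {x}, snd S) D"
    using assms(5) unfolding sys_contains_def sys_components_def quotient_def by auto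
  let ?C = "weakly_connected_rel S `` {x}" and ?C' = "weakly_connected_rel S' `` {h x}"
  have sub: "?C \<subseteq> fst S" "?C' \<subseteq> fst S'" by (auto simp: weakly_connected_rel_def)
  have closed: "snd S y \<in> ?C" if "y \<in> ?C" for y
  proof -
    have "y \<in> fst S" "(x, y) \<in> (sys_arcs S \<union> (sys_arcs S)\<inverse>)\<^sup>*"
      using that by (auto simp: weakly_connected_rel_def)
    moreover have "(y, snd S y) \<in> sys_arcs S \<union> (sys_arcs S)\<inverse>"
      using \<open>y \<in> fst S\<close> by (auto simp: sys_arcs_def)
    ultimately have "(x, snd S y) \<in> (sys_arcs S \<union> (sys_arcs S)\<inverse>)\<^sup>*"
      by (blast intro: rtrancl_into_rtrancl)
    then show ?thesis
      using x \<open>y \<in> fst S\<close> assms(1) by (simp add: weakly_connected_rel_def is_fdds_def)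
  qed
  have "h ` ?C = ?C'"
  proof (intro set_eqI iffI)
    fix z assume "z \<in> ?C'"
    with sub obtain y where "y \<in> fst S" "z = h y"
      using bij_betw_imp_surj_on[OF h(1)] by blast
    with \<open>z \<in> ?C'\<close> show "z \<in> h ` ?C" using iff[OF x, of y] by auto
  next
    fix z assume "z \<in> h ` ?C"
    then show "z \<in> ?C'" using iff[OF x] sub(1) by blast
  qed
  then have "bij_betw h ?C ?C'" using h(1) sub by (auto simp: bij_betw_def intro: inj_on_subset)
  then have iso: "sys_iso (?C, snd S) (?C', snd S')"
    by (rule_tac sys_isoI[of h]) (use h(2) sub in auto)
  have "is_fdds (?C, snd S)"
    using assms(1) sub closed finite_subset by (auto simp: is_fdds_def)
  with iso have "sys_iso (?C', snd S') (?C, snd S)" by (rule sys_iso_sym)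
  then have "sys_iso (?C', snd S') D'"
    using C assms(4) by (blast intro: sys_iso_trans)
  moreover have "(?C', snd S') \<in> sys_components S'"
    using x h(1) by (auto simp: sys_components_def quotient_def bij_betw_def)
  ultimately show ?thesis by (auto simp: sys_contains_def)
qed

lemma sys_connected_iso:
  assumes "is_fdds S" "is_fdds T" "sys_iso S T" "sys_connected S"
  shows "sys_connected T"
proof -
  obtain h where h: "bij_betw h (fst S) (fst T)"
    "\<And>x. x \<in> fst S \<Longrightarrow> h (snd S x) = snd T (h x)"
    using assms(3) unfolding sys_iso_def by blast
  have iff: "(h u, h v) \<in> weakly_connected_rel T \<longleftrightarrow> (u, v) \<in> weakly_connected_rel S"
    if "u \<in> fst S" "v \<in> fst S" for u v
    using assms(1,2) h that by (rule weakly_connected_rel_iso_iff)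
  have T: "fst T = h ` fst S" using h(1) by (simp add: bij_betw_def)
  have "(h u, h v) \<in> weakly_connected_rel T" if "u \<in> fst S" "v \<in> fst S" for u v
    using iff[OF that] assms(4) that by (simp add: sys_connected_def)
  then have "fst T \<times> fst T \<subseteq> weakly_connected_rel T"
    unfolding T by blast
  moreover have "weakly_connected_rel T \<subseteq> fst T \<times> fst T"
    by (auto simp: weakly_connected_rel_def)
  ultimately show ?thesis using assms(4) T by (auto simp: sys_connected_def)
qed

lemma card_cyclic_states_iso:
  assumes "is_fdds S" "sys_iso S T"
  shows "card (cyclic_states S) = card (cyclic_states T)"
proof -
  obtain h where h: "bij_betw h (fst S) (fst T)"
    "\<And>x. x \<in> fst S \<Longrightarrow> h (snd S x) = snd T (h x)"
    using assms(2) unfolding sys_iso_def by blast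
  have eq: "(snd T ^^ k) (h x) = h x \<longleftrightarrow> (snd S ^^ k) x = x" if "x \<in> fst S" for x k
  proof -
    have "h ((snd S ^^ k) x) = (snd T ^^ k) (h x)" "(snd S ^^ k) x \<in> fst S"
      using funpow_iso[of S h T x k, OF assms(1) h(2) that] by auto
    moreover have "inj_on h (fst S)" using h(1) by (rule bij_betw_imp_inj_on)
    ultimately show ?thesis using that by (metis inj_on_eq_iff)
  qed
  have "h ` cyclic_states S = cyclic_states T"
  proof -
    have T: "fst T = h ` fst S" using h(1) by (simp add: bij_betw_def)
    show ?thesis unfolding cyclic_states_def T using eq by blast
  qed
  moreover have "inj_on h (cyclic_states S)"
    using bij_betw_imp_inj_on[OF h(1)] by (rule inj_on_subset) (auto simp: cyclic_states_def)
  ultimately show ?thesis by (metis card_image)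
qed

text \<open>
  Every finite set embeds into the natural numbers, so the isomorphism classes of systems with
  carriers in \<^typ>\<open>nat\<close> are all the isomorphism classes (\<open>fdds_nat_representative\<close>).
  Sums and products are brought back to \<^typ>\<open>nat\<close> by relabelling the states.
\<close>

definition relabel :: "('a \<Rightarrow> 'b) \<Rightarrow> 'a sys \<Rightarrow> 'b sys" where
  "relabel e S = (e ` fst S, e \<circ> snd S \<circ> inv_into (fst S) e)"

lemma relabel_iso: "inj_on e (fst S) \<Longrightarrow> sys_iso S (relabel e S)"
  by (rule sys_isoI[of e]) (auto simp: relabel_def bij_betw_def)

lemma is_fdds_relabel: "inj_on e (fst S) \<Longrightarrow> is_fdds S \<Longrightarrow> is_fdds (relabel e S)"
  by (auto simp: relabel_def is_fdds_def)

lemma fdds_nat_representative: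
  assumes "is_fdds S"
  shows "\<exists>T :: nat sys. is_fdds T \<and> sys_iso S T"
proof -
  obtain e :: "_ \<Rightarrow> nat" where "inj_on e (fst S)"
    using assms finite_imp_inj_to_nat_seg[of "fst S"] by (auto simp: is_fdds_def)
  then have "is_fdds (relabel e S)" "sys_iso S (relabel e S)"
    using assms by (simp_all add: relabel_iso is_fdds_relabel)
  then show ?thesis by blast
qed

definition fdds_rel :: "nat sys \<Rightarrow> nat sys \<Rightarrow> bool" where
  "fdds_rel S T \<longleftrightarrow> is_fdds S \<and> is_fdds T \<and> sys_iso S T"

lemma fdds_rel_sym: "fdds_rel S T \<Longrightarrow> fdds_rel T S"
  unfolding fdds_rel_def using sys_iso_sym[of S T] by simp

lemma fdds_rel_trans: "fdds_rel S T \<Longrightarrow> fdds_rel T U \<Longrightarrow> fdds_rel S U"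
  unfolding fdds_rel_def using sys_iso_trans[of S T U] by simp

quotient_type fdds = "nat sys" / partial: fdds_rel
proof (rule part_equivpI)
  show "\<exists>S. fdds_rel S S"
    by (rule exI[of _ "({}, id)"]) (simp add: fdds_rel_def is_fdds_def)
  show "symp fdds_rel" by (rule sympI) (rule fdds_rel_sym)
  show "transp fdds_rel" by (rule transpI) (rule fdds_rel_trans)
qed

lemma sys_connected_rel: "fdds_rel S T \<Longrightarrow> sys_connected S \<Longrightarrow> sys_connected T"
  unfolding fdds_rel_def by (elim conjE) (rule sys_connected_iso)

lemma sys_contains_rel:
  "fdds_rel S S' \<Longrightarrow> fdds_rel D D' \<Longrightarrow> sys_contains S D \<Longrightarrow> sys_contains S' D'"
  unfolding fdds_rel_def by (elim conjE) (rule sys_contains_iso)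

lemma card_cyclic_states_rel:
  "fdds_rel S T \<Longrightarrow> card (cyclic_states S) = card (cyclic_states T)"
  unfolding fdds_rel_def by (elim conjE) (rule card_cyclic_states_iso)

lift_definition dendron :: "fdds \<Rightarrow> bool" is sys_dendron
  unfolding sys_dendron_def by (metis fdds_rel_sym sys_connected_rel card_cyclic_states_rel)

lift_definition contains :: "fdds \<Rightarrow> fdds \<Rightarrow> bool" is sys_contains
  by (metis fdds_rel_sym sys_contains_rel)

definition nat_sum :: "nat sys \<Rightarrow> nat sys \<Rightarrow> nat sys" where
  "nat_sum S T = relabel sum_encode (sys_sum S T)"

definition nat_prod :: "nat sys \<Rightarrow> nat sys \<Rightarrow> nat sys" where
  "nat_prod S T = relabel prod_encode (sys_prod S T)"

lemma nat_sum: "sys_iso (sys_sum S T) (nat_sum S T)"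
  unfolding nat_sum_def by (rule relabel_iso) (rule inj_sum_encode)

lemma nat_prod: "sys_iso (sys_prod S T) (nat_prod S T)"
  unfolding nat_prod_def by (rule relabel_iso) (rule inj_prod_encode)

lemma is_fdds_nat_sum: "is_fdds S \<Longrightarrow> is_fdds T \<Longrightarrow> is_fdds (nat_sum S T)"
  unfolding nat_sum_def by (intro is_fdds_relabel is_fdds_sum inj_sum_encode)

lemma is_fdds_nat_prod: "is_fdds S \<Longrightarrow> is_fdds T \<Longrightarrow> is_fdds (nat_prod S T)"
  unfolding nat_prod_def by (intro is_fdds_relabel is_fdds_prod inj_prod_encode)

lemma nat_sum': "is_fdds S \<Longrightarrow> is_fdds T \<Longrightarrow> sys_iso (nat_sum S T) (sys_sum S T)"
  by (intro sys_iso_sym[OF nat_sum] is_fdds_sum)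

lemma nat_prod': "is_fdds S \<Longrightarrow> is_fdds T \<Longrightarrow> sys_iso (nat_prod S T) (sys_prod S T)"
  by (intro sys_iso_sym[OF nat_prod] is_fdds_prod)

lemma nat_sum_cong:
  assumes "fdds_rel S S'" "fdds_rel T T'"
  shows "fdds_rel (nat_sum S T) (nat_sum S' T')"
proof -
  have *: "is_fdds S" "is_fdds S'" "sys_iso S S'" "is_fdds T" "is_fdds T'" "sys_iso T T'"
    using assms by (simp_all add: fdds_rel_def)
  have "sys_iso (nat_sum S T) (nat_sum S' T')"
    using nat_sum'[OF *(1,4)] sys_iso_sum[OF *(3,6)] nat_sum[of S' T'] sys_iso_trans by metis
  then show ?thesis using * by (simp add: fdds_rel_def is_fdds_nat_sum)
qed

lemma nat_prod_cong:
  assumes "fdds_rel S S'" "fdds_rel T T'"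
  shows "fdds_rel (nat_prod S T) (nat_prod S' T')"
proof -
  have *: "is_fdds S" "is_fdds S'" "sys_iso S S'" "is_fdds T" "is_fdds T'" "sys_iso T T'"
    using assms by (simp_all add: fdds_rel_def)
  have "sys_iso (nat_prod S T) (nat_prod S' T')"
    using nat_prod'[OF *(1,4)] sys_iso_prod[OF *(3,6)] nat_prod[of S' T'] sys_iso_trans by metis
  then show ?thesis using * by (simp add: fdds_rel_def is_fdds_nat_prod)
qed

lemma fdds_relI:
  assumes "is_fdds S'" "is_fdds T'" "sys_iso S S'" "sys_iso T T'"
    and "sys_iso S T" "is_fdds S" "is_fdds T"
  shows "fdds_rel S' T'"
proof -
  have "sys_iso S' S" using assms(3,6) by (rule sys_iso_sym)
  from sys_iso_trans[OF sys_iso_trans[OF this assms(5)] assms(4)]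
  show ?thesis using assms(1,2) by (simp add: fdds_rel_def)
qed

lemma nat_sum_sum1: "sys_iso (sys_sum (sys_sum S T) U) (nat_sum (nat_sum S T) U)"
  by (rule sys_iso_trans[OF sys_iso_sum[OF nat_sum sys_iso_refl] nat_sum])

lemma nat_sum_sum2: "sys_iso (sys_sum S (sys_sum T U)) (nat_sum S (nat_sum T U))"
  by (rule sys_iso_trans[OF sys_iso_sum[OF sys_iso_refl nat_sum] nat_sum])

lemma nat_prod_prod1: "sys_iso (sys_prod (sys_prod S T) U) (nat_prod (nat_prod S T) U)"
  by (rule sys_iso_trans[OF sys_iso_prod[OF nat_prod sys_iso_refl] nat_prod])

lemma nat_prod_prod2: "sys_iso (sys_prod S (sys_prod T U)) (nat_prod S (nat_prod T U))"
  by (rule sys_iso_trans[OF sys_iso_prod[OF sys_iso_refl nat_prod] nat_prod])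

lemma nat_prod_sum1: "sys_iso (sys_prod (sys_sum S T) U) (nat_prod (nat_sum S T) U)"
  by (rule sys_iso_trans[OF sys_iso_prod[OF nat_sum sys_iso_refl] nat_prod])

lemma nat_sum_prod1: "sys_iso (sys_sum (sys_prod S U) (sys_prod T U)) (nat_sum (nat_prod S U) (nat_prod T U))"
  by (rule sys_iso_trans[OF sys_iso_sum[OF nat_prod nat_prod] nat_sum])

lemmas is_fdds_intros = is_fdds_sum is_fdds_prod is_fdds_nat_sum is_fdds_nat_prod

lemma sys_sum_assoc: "sys_iso (sys_sum (sys_sum S T) U) (sys_sum S (sys_sum T U))"
  by (rule sys_isoI[of "case_sum (case_sum Inl (Inr \<circ> Inl)) (Inr \<circ> Inr)"],
      rule bij_betw_byWitness[of _ "case_sum (Inl \<circ> Inl) (case_sum (Inl \<circ> Inr) Inr)"])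
    (auto simp: sys_sum_def)

lemma sys_sum_commute: "sys_iso (sys_sum S T) (sys_sum T S)"
  by (rule sys_isoI[of "case_sum Inr Inl"], rule bij_betw_byWitness[of _ "case_sum Inr Inl"])
    (auto simp: sys_sum_def)

lemma sys_prod_assoc: "sys_iso (sys_prod (sys_prod S T) U) (sys_prod S (sys_prod T U))"
  by (rule sys_isoI[of "\<lambda>((a, b), c). (a, (b, c))"],
      rule bij_betw_byWitness[of _ "\<lambda>(a, (b, c)). ((a, b), c)"])
    (auto simp: sys_prod_def)

lemma sys_prod_commute: "sys_iso (sys_prod S T) (sys_prod T S)"
  by (rule sys_isoI[of prod.swap], rule bij_betw_byWitness[of _ prod.swap])
    (auto simp: sys_prod_def)

lemma sys_prod_sum_distrib:
  "sys_iso (sys_prod (sys_sum S T) U) (sys_sum (sys_prod S U) (sys_prod T U))"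
  by (rule sys_isoI[of "\<lambda>(s, u). case_sum (\<lambda>a. Inl (a, u)) (\<lambda>b. Inr (b, u)) s"],
      rule bij_betw_byWitness[of _ "case_sum (map_prod Inl id) (map_prod Inr id)"])
    (auto simp: sys_sum_def sys_prod_def)

lemma sys_sum_empty: "sys_iso (sys_sum ({}, f) S) S"
  by (rule sys_isoI[of "projr"], rule bij_betw_byWitness[of _ Inr])
    (auto simp: sys_sum_def)

lemma sys_prod_empty: "sys_iso (sys_prod ({}, f) S) ({}, g)"
  by (rule sys_isoI) (auto simp: sys_prod_def bij_betw_def)

lemma sys_prod_one: "sys_iso (sys_prod ({a}, id) S) S"
  by (rule sys_isoI[of snd], rule bij_betw_byWitness[of _ "Pair a"])
    (auto simp: sys_prod_def)

instantiation fdds :: comm_semiring_1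
begin

lift_definition zero_fdds :: fdds is "({}, id)"
  by (simp add: fdds_rel_def is_fdds_def)

lift_definition one_fdds :: fdds is "({0}, id)"
  by (simp add: fdds_rel_def is_fdds_def)

lift_definition plus_fdds :: "fdds \<Rightarrow> fdds \<Rightarrow> fdds" is nat_sum
  by (rule nat_sum_cong)

lift_definition times_fdds :: "fdds \<Rightarrow> fdds \<Rightarrow> fdds" is nat_prod
  by (rule nat_prod_cong)

instance
proof
  fix a b c :: fdds
  show "a + b + c = a + (b + c)"
    by transfer (rule fdds_relI[OF _ _ nat_sum_sum1 nat_sum_sum2 sys_sum_assoc];
        simp add: fdds_rel_def is_fdds_intros)
  show "a + b = b + a"
    by transfer (rule fdds_relI[OF _ _ nat_sum nat_sum sys_sum_commute];
        simp add: fdds_rel_def is_fdds_intros)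
  show "0 + a = a"
    by transfer (rule fdds_relI[OF _ _ nat_sum sys_iso_refl sys_sum_empty];
        simp add: fdds_rel_def is_fdds_intros is_fdds_def[of "({}, id)"])
  show "a * b * c = a * (b * c)"
    by transfer (rule fdds_relI[OF _ _ nat_prod_prod1 nat_prod_prod2 sys_prod_assoc];
        simp add: fdds_rel_def is_fdds_intros)
  show "a * b = b * a"
    by transfer (rule fdds_relI[OF _ _ nat_prod nat_prod sys_prod_commute];
        simp add: fdds_rel_def is_fdds_intros)
  show "1 * a = a"
    by transfer (rule fdds_relI[OF _ _ nat_prod sys_iso_refl sys_prod_one];
        simp add: fdds_rel_def is_fdds_intros is_fdds_def[of "({0}, id)"])
  show "(a + b) * c = a * c + b * c"
    by transfer (rule fdds_relI[OF _ _ nat_prod_sum1 nat_sum_prod1 sys_prod_sum_distrib];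
        simp add: fdds_rel_def is_fdds_intros)
  show zero: "0 * a = 0"
    by transfer (rule fdds_relI[OF _ _ nat_prod sys_iso_refl sys_prod_empty];
        simp add: fdds_rel_def is_fdds_intros is_fdds_def[of "({}, id)"])
  show "a * 0 = 0"
    by transfer (rule fdds_relI[OF _ _ nat_prod sys_iso_refl sys_iso_trans[OF sys_prod_commute sys_prod_empty]];
        simp add: fdds_rel_def is_fdds_intros is_fdds_def[of "({}, id)"])
  show "(0::fdds) \<noteq> 1"
    by transfer (auto simp: fdds_rel_def sys_iso_def bij_betw_def)
qed

end

end

theory Submission
  imports Defs "HOL-Library.FuncSet"
begin

text \<open>
  Following Lovasz, an FDDS is determined by the numbers \<open>hom(Z, X)\<close> of homomorphisms into it from
  connected systems \<open>Z\<close>, and for connected \<open>Z\<close> the map \<open>X \<mapsto> hom(Z, X)\<close> is a semiring homomorphism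
  into the natural numbers. A coefficient contains a dendron iff it has a fixed point.

  If \<open>A\<^sub>i\<close> with \<open>i > 0\<close> has a fixed point, then \<open>hom(Z, A\<^sub>i) > 0\<close> for all \<open>Z\<close>, so
  \<open>hom(Z, P(X)) = \<Sum>\<^sub>i hom(Z, A\<^sub>i) hom(Z, X)\<^sup>i\<close> is strictly increasing in \<open>hom(Z, X)\<close>, and \<open>P(X)\<close>
  determines \<open>X\<close>.

  Otherwise, let \<open>O\<close> range over the cycles of the \<open>A\<^sub>i\<close> with \<open>i > 0\<close>, and write the formal product
  of the differences \<open>|O| - O\<close> as \<open>X - Y\<close>. Whenever \<open>hom(Z, A\<^sub>i) > 0\<close>, the system \<open>Z\<close> maps to some \<open>O\<close>,
  and then \<open>hom(Z, O) = |O|\<close>, so \<open>hom(Z, X) = hom(Z, Y)\<close>. Hence \<open>P(X) = P(Y)\<close>. But \<open>X\<close> and \<open>Y\<close> have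
  different numbers of fixed points, since no \<open>O\<close> has one.
\<close>

section \<open>Weak connectivity\<close>

lemma weakly_connected_rel_refl: "x \<in> fst S \<Longrightarrow> (x, x) \<in> weakly_connected_rel S"
  by (simp add: weakly_connected_rel_def)

text \<open>Weak connectivity follows arcs in both directions, so a class contains a state exactly
  when it contains its image. This two-sided closure is what lets a component be split off as a
  system of its own.\<close>

lemma weakly_connected_rel_arc:
  assumes "is_fdds S" "y \<in> fst S"
  shows "(x, snd S y) \<in> weakly_connected_rel S \<longleftrightarrow> (x, y) \<in> weakly_connected_rel S"
proof -
  have "snd S y \<in> fst S" using assms by (simp add: is_fdds_def)
  moreover have "(y, snd S y) \<in> sys_arcs S" using assms(2) by (auto simp: sys_arcs_def)
  then have "(x, snd S y) \<in> (sys_arcs S \<union> (sys_arcs S)\<inverse>)\<^sup>*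
      \<longleftrightarrow> (x, y) \<in> (sys_arcs S \<union> (sys_arcs S)\<inverse>)\<^sup>*"
    by (meson UnCI converse_iff rtrancl.rtrancl_into_rtrancl)
  ultimately show ?thesis using assms(2) by (auto simp: weakly_connected_rel_def)
qed

lemma weakly_connected_rel_invariant:
  assumes "(x, y) \<in> weakly_connected_rel S" "P x"
    and "\<And>z. z \<in> fst S \<Longrightarrow> P (snd S z) \<longleftrightarrow> P z"
  shows "P y"
proof -
  have "(x, y) \<in> (sys_arcs S \<union> (sys_arcs S)\<inverse>)\<^sup>*"
    using assms(1) by (simp add: weakly_connected_rel_def)
  then show ?thesis
  proof induction
    case (step y z)
    then show ?case using assms(3) by (auto simp: sys_arcs_def)
  qed (rule assms(2))
qed

text \<open>The working form of connectivity: a two-sided invariant of single arcs spreads to all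
  states, so later proofs need not reason about paths.\<close>

lemma sys_connected_invariant:
  assumes "sys_connected S" "x \<in> fst S" "y \<in> fst S" "P x"
    and "\<And>z. z \<in> fst S \<Longrightarrow> P (snd S z) \<longleftrightarrow> P z"
  shows "P y"
  using assms by (intro weakly_connected_rel_invariant[of x y S P]) (auto simp: sys_connected_def)

lemma sys_components_closed:
  assumes "is_fdds S" "(C, f) \<in> sys_components S"
  shows "C \<subseteq> fst S" "f = snd S" "\<And>y. y \<in> fst S \<Longrightarrow> snd S y \<in> C \<longleftrightarrow> y \<in> C"
proof -
  obtain x where x: "C = weakly_connected_rel S `` {x}" "f = snd S"
    using assms(2) by (auto simp: sys_components_def quotient_def)
  then show "C \<subseteq> fst S" "f = snd S" by (auto simp: weakly_connected_rel_def)
  show "snd S y \<in> C \<longleftrightarrow> y \<in> C" if "y \<in> fst S" for y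
    using x(1) weakly_connected_rel_arc[OF assms(1) that] by simp
qed

lemma sys_connected_component:
  assumes "is_fdds S" "x \<in> fst S"
  defines "C \<equiv> weakly_connected_rel S `` {x}"
  shows "sys_connected (C, snd S)"
proof -
  have C: "C \<subseteq> fst S" by (auto simp: C_def weakly_connected_rel_def)
  have x: "x \<in> C" using assms(2) by (simp add: C_def weakly_connected_rel_refl)
  have closed: "snd S y \<in> C \<longleftrightarrow> y \<in> C" if "y \<in> fst S" for y
    using weakly_connected_rel_arc[OF assms(1) that] by (simp add: C_def)
  let ?E = "sys_arcs (C, snd S) \<union> (sys_arcs (C, snd S))\<inverse>"
  have reach: "(x, y) \<in> ?E\<^sup>*" if "y \<in> C" for y
  proof -
    have "(x, y) \<in> weakly_connected_rel S" using that by (simp add: C_def)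
    \<comment> \<open>Connectivity of \<open>(C, snd S)\<close> requires paths that stay inside
      \<open>C\<close>, so membership in \<open>C\<close> is carried along with
      reachability.\<close>
    then have "y \<in> C \<and> (x, y) \<in> ?E\<^sup>*"
    proof (rule weakly_connected_rel_invariant)
      fix z assume z: "z \<in> fst S"
      have "(z, snd S z) \<in> ?E" "(snd S z, z) \<in> ?E" if "z \<in> C"
        using that by (auto simp: sys_arcs_def)
      then show "snd S z \<in> C \<and> (x, snd S z) \<in> ?E\<^sup>* \<longleftrightarrow> z \<in> C \<and> (x, z) \<in> ?E\<^sup>*"
        using closed[OF z] by (meson rtrancl.rtrancl_into_rtrancl)
    qed (use x in simp)
    then show ?thesis ..
  qed
  have "sym (?E\<^sup>*)" by (intro sym_rtrancl sym_Un_converse)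
  then have "(y, z) \<in> ?E\<^sup>*" if "y \<in> C" "z \<in> C" for y z
    using reach[OF that(1)] reach[OF that(2)] by (meson rtrancl_trans symD)
  then show ?thesis
    using x by (auto simp: sys_connected_def weakly_connected_rel_def)
qed

text \<open>The image of a cyclic state is cyclic, so a lone cyclic state of a component must be
  fixed. Conversely, every state in the component of a fixed point \<open>x\<close> eventually
  reaches \<open>x\<close>, and a cyclic state that reaches \<open>x\<close> can never leave it
  again, so it is \<open>x\<close>.\<close>

lemma contains_dendron_iff_fixed_point:
  assumes "is_fdds S"
  shows "(\<exists>D :: nat sys. is_fdds D \<and> sys_dendron D \<and> sys_contains S D)
    \<longleftrightarrow> (\<exists>x\<in>fst S. snd S x = x)"
proof
  assume "\<exists>D :: nat sys. is_fdds D \<and> sys_dendron D \<and> sys_contains S D"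
  then obtain D :: "nat sys" and C f where D: "is_fdds D" "card (cyclic_states D) = 1"
    and C: "(C, f) \<in> sys_components S" "sys_iso (C, f) D"
    unfolding sys_contains_def sys_dendron_def by auto
  note cl = sys_components_closed[OF assms C(1)]
  have "is_fdds (C, f)"
    using cl assms by (auto simp: is_fdds_def intro: finite_subset)
  then have "card (cyclic_states (C, f)) = 1"
    using card_cyclic_states_iso C(2) D(2) by metis
  then obtain x where x: "cyclic_states (C, f) = {x}" by (auto simp: card_1_singleton_iff)
  then obtain k where k: "x \<in> C" "(f ^^ k) x = x" "k > 0" by (auto simp: cyclic_states_def)
  have "(f ^^ k) (f x) = f x" using k(2) by (metis funpow_swap1)
  moreover have "f x \<in> C" using k cl by auto
  ultimately have "f x \<in> cyclic_states (C, f)" using k(3) by (auto simp: cyclic_states_def)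
  then show "\<exists>x\<in>fst S. snd S x = x" using x k cl by auto
next
  assume "\<exists>x\<in>fst S. snd S x = x"
  then obtain x where x: "x \<in> fst S" "snd S x = x" by blast
  define C where "C = weakly_connected_rel S `` {x}"
  have comp: "(C, snd S) \<in> sys_components S"
    using x by (auto simp: sys_components_def quotient_def C_def)
  note cl = sys_components_closed[OF assms comp]
  have fdds: "is_fdds (C, snd S)"
    using cl assms by (auto simp: is_fdds_def intro: finite_subset)
  have conn: "sys_connected (C, snd S)"
    unfolding C_def using assms x(1) by (rule sys_connected_component)
  have fx: "(snd S ^^ n) x = x" for n by (induction n) (simp_all add: x)
  have xC: "x \<in> C" using x by (simp add: C_def weakly_connected_rel_refl)
  \<comment> \<open>Since \<open>x\<close> is fixed, a state reaches \<open>x\<close> iff its image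
    does, so the property spreads over the component.\<close>
  have reach: "\<exists>n. (snd S ^^ n) y = x" if "y \<in> C" for y
  proof (rule sys_connected_invariant[OF conn, of x y])
    fix z
    show "(\<exists>n. (snd S ^^ n) (snd (C, snd S) z) = x) \<longleftrightarrow> (\<exists>n. (snd S ^^ n) z = x)"
      using x(2) by (metis funpow_Suc_right comp_apply funpow_swap1 snd_conv)
  qed (use that xC fx in auto)
  have "y = x" if "y \<in> cyclic_states (C, snd S)" for y
  proof -
    from that obtain k where k: "k > 0" "(snd S ^^ k) y = y" "y \<in> C"
      by (auto simp: cyclic_states_def)
    obtain n where n: "(snd S ^^ n) y = x" using reach k(3) by blast
    \<comment> \<open>After \<open>k * n\<close> steps \<open>y\<close> is back at itself; but
      \<open>k * n\<close> is at least \<open>n\<close>, and from step \<open>n\<close> on the orbit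
      of \<open>y\<close> stays at \<open>x\<close>.\<close>
    have "((snd S ^^ k) ^^ n) y = y" by (induction n) (simp_all add: k)
    then have "(snd S ^^ (k * n)) y = y" by (simp add: funpow_mult mult.commute)
    moreover have "k * n = (k * n - n) + n" using k(1) by (cases k) auto
    then have "(snd S ^^ (k * n)) y = x" using n fx by (metis funpow_add comp_apply)
    ultimately show ?thesis by simp
  qed
  moreover have "x \<in> cyclic_states (C, snd S)"
    using xC x(2) by (auto simp: cyclic_states_def intro: exI[of _ 1])
  ultimately have "cyclic_states (C, snd S) = {x}" by blast
  then have "card (cyclic_states (C, snd S)) = 1" by simp
  moreover obtain D :: "nat sys" where D: "is_fdds D" "sys_iso (C, snd S) D"
    using fdds_nat_representative[OF fdds] by blast
  ultimately have "sys_dendron D"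
    unfolding sys_dendron_def
    using sys_connected_iso[OF fdds D conn] card_cyclic_states_iso[OF fdds D(2)] by simp
  then show "\<exists>D :: nat sys. is_fdds D \<and> sys_dendron D \<and> sys_contains S D"
    using D(1) comp D(2) unfolding sys_contains_def by blast
qed

section \<open>Counting homomorphisms\<close>

text \<open>Extensionality gives each homomorphism a single representing function, so that
  \<open>card\<close> counts homomorphisms on the carrier.\<close>

definition sys_homs :: "'a sys \<Rightarrow> 'b sys \<Rightarrow> ('a \<Rightarrow> 'b) set" where
  "sys_homs S T = {h \<in> fst S \<rightarrow>\<^sub>E fst T. \<forall>x\<in>fst S. h (snd S x) = snd T (h x)}"

lemma sys_homs_in: "h \<in> sys_homs S T \<Longrightarrow> x \<in> fst S \<Longrightarrow> h x \<in> fst T"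
  by (auto simp: sys_homs_def)

lemma sys_homs_eq: "h \<in> sys_homs S T \<Longrightarrow> x \<in> fst S \<Longrightarrow> h (snd S x) = snd T (h x)"
  by (auto simp: sys_homs_def)

lemma sys_homs_ext:
  "h \<in> sys_homs S T \<Longrightarrow> k \<in> sys_homs S T \<Longrightarrow> (\<And>x. x \<in> fst S \<Longrightarrow> h x = k x) \<Longrightarrow> h = k"
  unfolding sys_homs_def by (auto intro: PiE_ext)

lemma restrict_sys_homs:
  assumes "is_fdds S" "\<And>x. x \<in> fst S \<Longrightarrow> h x \<in> fst T"
    and "\<And>x. x \<in> fst S \<Longrightarrow> h (snd S x) = snd T (h x)"
  shows "restrict h (fst S) \<in> sys_homs S T"
  using assms by (auto simp: sys_homs_def is_fdds_def)

lemma sys_homs_undefined: "h \<in> sys_homs S T \<Longrightarrow> x \<notin> fst S \<Longrightarrow> h x = undefined"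
  by (auto simp: sys_homs_def)

lemma restrict_sys_homs_id: "h \<in> sys_homs S T \<Longrightarrow> restrict h (fst S) = h"
  by (auto simp: sys_homs_def)

lemma finite_sys_homs: "is_fdds S \<Longrightarrow> is_fdds T \<Longrightarrow> finite (sys_homs S T)"
  by (rule finite_subset[of _ "fst S \<rightarrow>\<^sub>E fst T"])
    (auto simp: sys_homs_def is_fdds_def intro: finite_PiE)

lemma card_sys_homs_le_iso:
  assumes "is_fdds Z" "is_fdds S" "is_fdds T" "sys_iso S T"
  shows "card (sys_homs Z S) \<le> card (sys_homs Z T)"
proof -
  obtain h where h: "bij_betw h (fst S) (fst T)"
    "\<And>x. x \<in> fst S \<Longrightarrow> h (snd S x) = snd T (h x)"
    using assms(4) unfolding sys_iso_def by blast
  show ?thesis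
  proof (rule card_inj_on_le[where f = "\<lambda>k. restrict (h \<circ> k) (fst Z)"])
    show "inj_on (\<lambda>k. restrict (h \<circ> k) (fst Z)) (sys_homs Z S)"
    proof (intro inj_onI sys_homs_ext)
      fix k l x assume kl: "k \<in> sys_homs Z S" "l \<in> sys_homs Z S" "x \<in> fst Z"
        and "restrict (h \<circ> k) (fst Z) = restrict (h \<circ> l) (fst Z)"
      then have "h (k x) = h (l x)" by (metis comp_apply restrict_apply')
      then show "k x = l x"
        using kl h(1) by (meson bij_betw_imp_inj_on inj_onD sys_homs_in)
    qed
    show "(\<lambda>k. restrict (h \<circ> k) (fst Z)) ` sys_homs Z S \<subseteq> sys_homs Z T"
      using h bij_betwE[OF h(1)]
      by (auto intro!: restrict_sys_homs assms simp: sys_homs_in sys_homs_eq)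
    show "finite (sys_homs Z T)" using assms by (intro finite_sys_homs)
  qed
qed

lemma card_sys_homs_iso:
  assumes "is_fdds Z" "is_fdds S" "is_fdds T" "sys_iso S T"
  shows "card (sys_homs Z S) = card (sys_homs Z T)"
  using card_sys_homs_le_iso[OF assms] card_sys_homs_le_iso[OF assms(1,3,2)]
    sys_iso_sym[OF assms(4,2)] by simp

text \<open>Universal property of the product: the two coordinates of a homomorphism are
  homomorphisms that can be chosen independently.\<close>

lemma card_sys_homs_prod:
  assumes "is_fdds Z"
  shows "card (sys_homs Z (sys_prod S T)) = card (sys_homs Z S) * card (sys_homs Z T)"
proof -
  have "bij_betw (\<lambda>(h, k). restrict (\<lambda>x. (h x, k x)) (fst Z))
    (sys_homs Z S \<times> sys_homs Z T) (sys_homs Z (sys_prod S T))"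
  proof (rule bij_betw_byWitness[where
        f' = "\<lambda>p. (restrict (fst \<circ> p) (fst Z), restrict (snd \<circ> p) (fst Z))"])
    show "(\<lambda>(h, k). restrict (\<lambda>x. (h x, k x)) (fst Z)) ` (sys_homs Z S \<times> sys_homs Z T)
      \<subseteq> sys_homs Z (sys_prod S T)"
      by (auto intro!: restrict_sys_homs assms simp: sys_homs_in sys_homs_eq sys_prod_def)
    have p: "p x \<in> fst S \<times> fst T" "p (snd Z x) = map_prod (snd S) (snd T) (p x)"
      if "p \<in> sys_homs Z (sys_prod S T)" "x \<in> fst Z" for p x
      using sys_homs_in[OF that] sys_homs_eq[OF that] by (simp_all add: sys_prod_def)
    show "(\<lambda>p. (restrict (fst \<circ> p) (fst Z), restrict (snd \<circ> p) (fst Z))) `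
        sys_homs Z (sys_prod S T) \<subseteq> sys_homs Z S \<times> sys_homs Z T"
      using p by (auto intro!: restrict_sys_homs assms simp: mem_Times_iff) (metis fst_map_prod, metis snd_map_prod)
    show "\<forall>a\<in>sys_homs Z S \<times> sys_homs Z T.
      (restrict (fst \<circ> (\<lambda>(h, k). restrict (\<lambda>x. (h x, k x)) (fst Z)) a) (fst Z),
       restrict (snd \<circ> (\<lambda>(h, k). restrict (\<lambda>x. (h x, k x)) (fst Z)) a) (fst Z)) = a"
    proof
      fix a assume "a \<in> sys_homs Z S \<times> sys_homs Z T"
      then obtain h k where a: "a = (h, k)" "h \<in> sys_homs Z S" "k \<in> sys_homs Z T" by auto
      show "(restrict (fst \<circ> (\<lambda>(h, k). restrict (\<lambda>x. (h x, k x)) (fst Z)) a) (fst Z),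
       restrict (snd \<circ> (\<lambda>(h, k). restrict (\<lambda>x. (h x, k x)) (fst Z)) a) (fst Z)) = a"
        using restrict_sys_homs_id[OF a(2)] restrict_sys_homs_id[OF a(3)]
        by (simp add: a(1) comp_def cong: restrict_cong)
    qed
    show "\<forall>p\<in>sys_homs Z (sys_prod S T).
      (\<lambda>(h, k). restrict (\<lambda>x. (h x, k x)) (fst Z))
        (restrict (fst \<circ> p) (fst Z), restrict (snd \<circ> p) (fst Z)) = p"
    proof
      fix p assume "p \<in> sys_homs Z (sys_prod S T)"
      from sys_homs_undefined[OF this]
      show "(\<lambda>(h, k). restrict (\<lambda>x. (h x, k x)) (fst Z))
        (restrict (fst \<circ> p) (fst Z), restrict (snd \<circ> p) (fst Z)) = p"
        by (auto simp: fun_eq_iff restrict_def)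
    qed
  qed
  from bij_betw_same_card[OF this] show ?thesis by (simp add: card_cartesian_product)
qed

text \<open>Arcs of a sum never cross between the summands, so a connected system is mapped entirely
  into one of them.\<close>

lemma card_sys_homs_sum:
  assumes "is_fdds Z" "is_fdds S" "is_fdds T" "sys_connected Z"
  shows "card (sys_homs Z (sys_sum S T)) = card (sys_homs Z S) + card (sys_homs Z T)"
proof -
  let ?l = "\<lambda>h. restrict (Inl \<circ> h) (fst Z) :: _ \<Rightarrow> _ + _"
  let ?r = "\<lambda>h. restrict (Inr \<circ> h) (fst Z) :: _ \<Rightarrow> _ + _"
  obtain z where z: "z \<in> fst Z" using assms(4) by (auto simp: sys_connected_def)
  have l: "inj_on ?l (sys_homs Z S)"
    by (intro inj_onI sys_homs_ext; assumption?) (metis comp_apply restrict_apply' sum.inject(1))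
  have r: "inj_on ?r (sys_homs Z T)"
    by (intro inj_onI sys_homs_ext; assumption?) (metis comp_apply restrict_apply' sum.inject(2))
  \<comment> \<open>This uses that \<open>Z\<close> has a state: on an empty carrier both injections
    would yield the same function.\<close>
  have disj: "?l ` sys_homs Z S \<inter> ?r ` sys_homs Z T = {}"
  proof -
    have "?l h \<noteq> ?r k" for h k
      using z by (metis comp_apply restrict_apply' sum.distinct(1))
    then show ?thesis by blast
  qed
  have "sys_homs Z (sys_sum S T) = ?l ` sys_homs Z S \<union> ?r ` sys_homs Z T"
  proof (intro equalityI subsetI)
    fix p assume p: "p \<in> sys_homs Z (sys_sum S T)"
    have pin: "p x \<in> fst S <+> fst T" and peq: "p (snd Z x) = map_sum (snd S) (snd T) (p x)"
      if "x \<in> fst Z" for x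
      using sys_homs_in[OF p that] sys_homs_eq[OF p that] by (simp_all add: sys_sum_def)
    have side: "isl (p x) \<longleftrightarrow> isl (p z)" if "x \<in> fst Z" for x
      using peq by (intro sys_connected_invariant[OF assms(4) z that,
        where P = "\<lambda>x. isl (p x) \<longleftrightarrow> isl (p z)"]) (auto simp: isl_map_sum)
    show "p \<in> ?l ` sys_homs Z S \<union> ?r ` sys_homs Z T"
    proof (cases "isl (p z)")
      case True
      then have s: "p x = Inl (projl (p x))" if "x \<in> fst Z" for x using side[OF that] by simp
      have "restrict (projl \<circ> p) (fst Z) \<in> sys_homs Z S"
      proof (rule restrict_sys_homs[OF assms(1)])
        fix x assume x: "x \<in> fst Z"
        have "Inl (projl (p x)) \<in> fst S <+> fst T" using pin[OF x] s[OF x] by simp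
        then show "(projl \<circ> p) x \<in> fst S" by auto
        show "(projl \<circ> p) (snd Z x) = snd S ((projl \<circ> p) x)"
          using peq[OF x] s[OF x] by (metis comp_apply map_sum.simps(1) sum.sel(1))
      qed
      moreover have "p = ?l (restrict (projl \<circ> p) (fst Z))"
        using sys_homs_undefined[OF p] s by (auto simp: fun_eq_iff restrict_def)
      ultimately show ?thesis by blast
    next
      case False
      then have s: "p x = Inr (projr (p x))" if "x \<in> fst Z" for x using side[OF that] by simp
      have "restrict (projr \<circ> p) (fst Z) \<in> sys_homs Z T"
      proof (rule restrict_sys_homs[OF assms(1)])
        fix x assume x: "x \<in> fst Z"
        have "Inr (projr (p x)) \<in> fst S <+> fst T" using pin[OF x] s[OF x] by simp
        then show "(projr \<circ> p) x \<in> fst T" by auto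
        show "(projr \<circ> p) (snd Z x) = snd T ((projr \<circ> p) x)"
          using peq[OF x] s[OF x] by (metis comp_apply map_sum.simps(2) sum.sel(2))
      qed
      moreover have "p = ?r (restrict (projr \<circ> p) (fst Z))"
        using sys_homs_undefined[OF p] s by (auto simp: fun_eq_iff restrict_def)
      ultimately show ?thesis by blast
    qed
  qed (auto intro!: restrict_sys_homs assms simp: sys_homs_in sys_homs_eq sys_sum_def)
  then show ?thesis
    using assms by (simp add: card_Un_disjoint disj finite_sys_homs card_image l r)
qed

text \<open>A set of states closed under images and preimages makes \<open>Z\<close> a disjoint
  union, and homomorphisms on the two pieces glue without any condition.\<close>

lemma card_sys_homs_split:
  assumes "is_fdds Z" "U \<subseteq> fst Z" "\<And>x. x \<in> fst Z \<Longrightarrow> snd Z x \<in> U \<longleftrightarrow> x \<in> U"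
  shows "card (sys_homs Z T) = card (sys_homs (U, snd Z) T) * card (sys_homs (fst Z - U, snd Z) T)"
proof -
  let ?V = "fst Z - U"
  have U: "is_fdds (U, snd Z)" and V: "is_fdds (?V, snd Z)"
    using assms by (auto simp: is_fdds_def intro: finite_subset)
  let ?glue = "\<lambda>(a, b). restrict (\<lambda>x. if x \<in> U then a x else b x) (fst Z)"
  have "bij_betw ?glue (sys_homs (U, snd Z) T \<times> sys_homs (?V, snd Z) T) (sys_homs Z T)"
  proof (rule bij_betw_byWitness[where f' = "\<lambda>h. (restrict h U, restrict h ?V)"])
    have "?glue (a, b) \<in> sys_homs Z T"
      if ab: "a \<in> sys_homs (U, snd Z) T" "b \<in> sys_homs (?V, snd Z) T" for a b
      unfolding prod.case using assms(1)
    proof (rule restrict_sys_homs)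
      fix x assume "x \<in> fst Z"
      then show "(if x \<in> U then a x else b x) \<in> fst T"
        "(if snd Z x \<in> U then a (snd Z x) else b (snd Z x)) = snd T (if x \<in> U then a x else b x)"
        using assms(3) sys_homs_in[OF ab(1)] sys_homs_in[OF ab(2)]
          sys_homs_eq[OF ab(1)] sys_homs_eq[OF ab(2)] by auto
    qed
    then show "?glue ` (sys_homs (U, snd Z) T \<times> sys_homs (?V, snd Z) T) \<subseteq> sys_homs Z T" by blast
    have "restrict h U \<in> sys_homs (U, snd Z) T" "restrict h ?V \<in> sys_homs (?V, snd Z) T"
      if "h \<in> sys_homs Z T" for h
      using that assms(2) restrict_sys_homs[OF U, of h T] restrict_sys_homs[OF V, of h T]
      by (auto simp: sys_homs_in sys_homs_eq subset_iff)
    then show "(\<lambda>h. (restrict h U, restrict h ?V)) ` sys_homs Z T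
        \<subseteq> sys_homs (U, snd Z) T \<times> sys_homs (?V, snd Z) T" by blast
    have "restrict (?glue (a, b)) U = a \<and> restrict (?glue (a, b)) ?V = b"
      if ab: "a \<in> sys_homs (U, snd Z) T" "b \<in> sys_homs (?V, snd Z) T" for a b
    proof
      have "restrict (?glue (a, b)) U = restrict a U" "restrict (?glue (a, b)) ?V = restrict b ?V"
        using assms(2) by (auto simp: restrict_def fun_eq_iff)
      then show "restrict (?glue (a, b)) U = a" "restrict (?glue (a, b)) ?V = b"
        using restrict_sys_homs_id[OF ab(1)] restrict_sys_homs_id[OF ab(2)] by simp_all
    qed
    then show "\<forall>c\<in>sys_homs (U, snd Z) T \<times> sys_homs (?V, snd Z) T.
        (restrict (?glue c) U, restrict (?glue c) ?V) = c" by auto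
    have "?glue (restrict h U, restrict h ?V) = h" if "h \<in> sys_homs Z T" for h
      using sys_homs_undefined[OF that] by (auto simp: fun_eq_iff restrict_def)
    then show "\<forall>h\<in>sys_homs Z T. ?glue (restrict h U, restrict h ?V) = h" by blast
  qed
  from bij_betw_same_card[OF this] show ?thesis by (simp add: card_cartesian_product)
qed

text \<open>Induction on the number of states: a non-empty disconnected system splits into the
  component of one state and the rest, and the counts multiply. The passage to arbitrary
  \<open>Z\<close> is needed because Lovasz's argument tests with the systems \<open>S\<close> and
  \<open>T\<close> themselves.\<close>

lemma card_sys_homs_eq_if_connected:
  assumes "\<And>Z :: 'a sys. is_fdds Z \<Longrightarrow> sys_connected Z \<Longrightarrow>
      card (sys_homs Z S) = card (sys_homs Z T)"
  shows "is_fdds (Z :: 'a sys) \<Longrightarrow> card (sys_homs Z S) = card (sys_homs Z T)"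
proof (induction "card (fst Z)" arbitrary: Z rule: less_induct)
  case less
  consider "fst Z = {}" | "sys_connected Z" | "fst Z \<noteq> {}" "\<not> sys_connected Z" by blast
  then show ?case
  proof cases
    case 1
    then show ?thesis by (simp add: sys_homs_def)
  next
    case 2
    with less.prems show ?thesis by (rule assms)
  next
    case 3
    then have "weakly_connected_rel Z \<noteq> fst Z \<times> fst Z" by (simp add: sys_connected_def)
    moreover have "weakly_connected_rel Z \<subseteq> fst Z \<times> fst Z"
      by (simp add: weakly_connected_rel_def)
    ultimately obtain x y where xy: "x \<in> fst Z" "y \<in> fst Z" "(x, y) \<notin> weakly_connected_rel Z"
      by auto
    define U where "U = weakly_connected_rel Z `` {x}"
    have U: "U \<subseteq> fst Z" "x \<in> U" "y \<notin> U"
      using xy by (auto simp: U_def weakly_connected_rel_def)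
    have cl: "snd Z z \<in> U \<longleftrightarrow> z \<in> U" if "z \<in> fst Z" for z
      using weakly_connected_rel_arc[OF less.prems that] by (simp add: U_def)
    have fin: "finite (fst Z)" using less.prems by (simp add: is_fdds_def)
    have "is_fdds (U, snd Z)" "is_fdds (fst Z - U, snd Z)"
      using U less.prems cl by (auto simp: is_fdds_def intro: finite_subset)
    moreover have "card U < card (fst Z)" "card (fst Z - U) < card (fst Z)"
      using U xy fin by (auto intro!: psubset_card_mono)
    ultimately have "card (sys_homs (U, snd Z) S) = card (sys_homs (U, snd Z) T)"
      "card (sys_homs (fst Z - U, snd Z) S) = card (sys_homs (fst Z - U, snd Z) T)"
      using less.hyps by simp_all
    then show ?thesis
      using card_sys_homs_split[OF less.prems U(1) cl, of S]
        card_sys_homs_split[OF less.prems U(1) cl, of T] by simp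
  qed
qed

section \<open>Homomorphism counts determine a system\<close>

definition sys_embs :: "'a sys \<Rightarrow> 'b sys \<Rightarrow> ('a \<Rightarrow> 'b) set" where
  "sys_embs S T = {h \<in> sys_homs S T. inj_on h (fst S)}"

text \<open>
  Congruences are encoded by the map sending a state to the least state congruent to it, so that
  quotients of systems of natural numbers are again systems of natural numbers.
\<close>

definition kernel_rep :: "nat set \<Rightarrow> (nat \<Rightarrow> 'b) \<Rightarrow> nat \<Rightarrow> nat" where
  "kernel_rep C h = (\<lambda>x\<in>C. LEAST y. y \<in> C \<and> h y = h x)"

definition sys_congruences :: "nat sys \<Rightarrow> (nat \<Rightarrow> nat) set" where
  "sys_congruences Z = {s. kernel_rep (fst Z) s = s \<and>
     (\<forall>x\<in>fst Z. s (snd Z (s x)) = s (snd Z x))}"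

definition sys_quotient :: "nat sys \<Rightarrow> (nat \<Rightarrow> nat) \<Rightarrow> nat sys" where
  "sys_quotient Z s = (s ` fst Z, s \<circ> snd Z)"

lemma kernel_rep_in:
  assumes "x \<in> C"
  shows "kernel_rep C h x \<in> C" "h (kernel_rep C h x) = h x"
  using LeastI[of "\<lambda>y. y \<in> C \<and> h y = h x" x] assms by (simp_all add: kernel_rep_def)

lemma kernel_rep_eq_iff:
  assumes "x \<in> C" "y \<in> C"
  shows "kernel_rep C h x = kernel_rep C h y \<longleftrightarrow> h x = h y"
proof
  assume "kernel_rep C h x = kernel_rep C h y"
  then show "h x = h y" using kernel_rep_in(2)[OF assms(1)] kernel_rep_in(2)[OF assms(2)] by metis
qed (use assms in \<open>simp add: kernel_rep_def\<close>)

lemma kernel_rep_cong: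
  assumes "\<And>x y. x \<in> C \<Longrightarrow> y \<in> C \<Longrightarrow> h x = h y \<longleftrightarrow> k x = k y"
  shows "kernel_rep C h = kernel_rep C k"
  unfolding kernel_rep_def
  by (intro restrict_ext arg_cong[where f = Least] ext) (use assms in blast)

lemma kernel_rep_idem: "kernel_rep C (kernel_rep C h) = kernel_rep C h"
  by (rule kernel_rep_cong) (rule kernel_rep_eq_iff)

lemma sys_congruencesD:
  assumes "s \<in> sys_congruences Z" "x \<in> fst Z"
  shows "s x \<in> fst Z" "s (s x) = s x" "s (snd Z (s x)) = s (snd Z x)"
  using assms kernel_rep_in[OF assms(2), of s] by (simp_all add: sys_congruences_def)

lemma finite_sys_congruences:
  assumes "is_fdds Z"
  shows "finite (sys_congruences Z)"
proof (rule finite_subset)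
  show "sys_congruences Z \<subseteq> fst Z \<rightarrow>\<^sub>E fst Z"
  proof
    fix s assume s: "s \<in> sys_congruences Z"
    then have "s = kernel_rep (fst Z) s" by (simp add: sys_congruences_def)
    then have "s \<in> extensional (fst Z)" by (metis kernel_rep_def restrict_extensional)
    then show "s \<in> fst Z \<rightarrow>\<^sub>E fst Z" using sys_congruencesD(1)[OF s] by (auto simp: PiE_def)
  qed
  show "finite (fst Z \<rightarrow>\<^sub>E fst Z)" using assms by (simp add: is_fdds_def finite_PiE)
qed

lemma kernel_rep_sys_homs:
  assumes "is_fdds Z" "h \<in> sys_homs Z T"
  shows "kernel_rep (fst Z) h \<in> sys_congruences Z"
proof -
  let ?s = "kernel_rep (fst Z) h"
  have "?s (snd Z (?s x)) = ?s (snd Z x)" if x: "x \<in> fst Z" for x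
  proof -
    have "?s x \<in> fst Z" "h (?s x) = h x" using x by (auto simp: kernel_rep_in)
    then show ?thesis
      using x assms by (subst kernel_rep_eq_iff) (auto simp: sys_homs_eq is_fdds_def)
  qed
  then show ?thesis by (simp add: sys_congruences_def kernel_rep_idem)
qed

lemma is_fdds_sys_quotient:
  assumes "is_fdds Z" "s \<in> sys_congruences Z"
  shows "is_fdds (sys_quotient Z s)"
  using assms sys_congruencesD(1)[OF assms(2)] by (auto simp: sys_quotient_def is_fdds_def)

text \<open>A homomorphism with kernel \<open>s\<close> factors uniquely through the quotient by
  \<open>s\<close>, and the second factor is injective. As the states of the quotient are
  representatives inside \<open>Z\<close>, this factor is just the restriction of the
  homomorphism.\<close>

lemma card_sys_homs_kernel:
  assumes "is_fdds Z" "s \<in> sys_congruences Z"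
  shows "card {h \<in> sys_homs Z T. kernel_rep (fst Z) h = s} = card (sys_embs (sys_quotient Z s) T)"
proof -
  let ?Q = "sys_quotient Z s" and ?C = "fst Z"
  note s = sys_congruencesD[OF assms(2)]
  note Q = is_fdds_sys_quotient[OF assms]
  have Q_simps: "fst ?Q = s ` ?C" "snd ?Q y = s (snd Z y)" for y
    by (simp_all add: sys_quotient_def)
  have "bij_betw (\<lambda>g. restrict (g \<circ> s) ?C) (sys_embs ?Q T) {h \<in> sys_homs Z T. kernel_rep ?C h = s}"
  proof (rule bij_betw_byWitness[where f' = "\<lambda>h. restrict h (fst ?Q)"])
    have "restrict (g \<circ> s) ?C \<in> sys_homs Z T \<and> kernel_rep ?C (restrict (g \<circ> s) ?C) = s"
      if g: "g \<in> sys_homs ?Q T" "inj_on g (fst ?Q)" for g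
    proof
      show "restrict (g \<circ> s) ?C \<in> sys_homs Z T"
      proof (rule restrict_sys_homs[OF assms(1)])
        fix x assume x: "x \<in> ?C"
        then have sx: "s x \<in> fst ?Q" by (simp add: Q_simps)
        from sys_homs_in[OF g(1) sx] show "(g \<circ> s) x \<in> fst T" by simp
        from sys_homs_eq[OF g(1) sx] show "(g \<circ> s) (snd Z x) = snd T ((g \<circ> s) x)"
          using s(3)[OF x] by (simp add: Q_simps)
      qed
      have "kernel_rep ?C (restrict (g \<circ> s) ?C) = kernel_rep ?C s"
        using g(2) by (intro kernel_rep_cong) (auto simp: Q_simps inj_on_eq_iff)
      then show "kernel_rep ?C (restrict (g \<circ> s) ?C) = s"
        using assms(2) by (simp add: sys_congruences_def)
    qed
    then show "(\<lambda>g. restrict (g \<circ> s) ?C) ` sys_embs ?Q T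
        \<subseteq> {h \<in> sys_homs Z T. kernel_rep ?C h = s}"
      by (auto simp: sys_embs_def)
    have h_s: "h (s x) = h x" "s x = s y \<longleftrightarrow> h x = h y"
      if "kernel_rep ?C h = s" "x \<in> ?C" "y \<in> ?C" for h :: "nat \<Rightarrow> 'a" and x y
      using kernel_rep_in(2)[OF that(2), of h] kernel_rep_eq_iff[OF that(2,3), of h] that(1)
      by simp_all
    have "restrict h (fst ?Q) \<in> sys_embs ?Q T"
      if h: "h \<in> sys_homs Z T" "kernel_rep ?C h = s" for h
    proof -
      have "restrict h (fst ?Q) \<in> sys_homs ?Q T"
      proof (rule restrict_sys_homs[OF Q])
        fix y assume "y \<in> fst ?Q"
        then have y: "y \<in> ?C" using s(1) by (auto simp: Q_simps)
        then have fy: "snd Z y \<in> ?C" using assms(1) by (simp add: is_fdds_def)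
        show "h y \<in> fst T" using y h(1) by (simp add: sys_homs_in)
        show "h (snd ?Q y) = snd T (h y)"
          using h_s(1)[OF h(2) fy fy] sys_homs_eq[OF h(1) y] by (simp add: Q_simps)
      qed
      moreover have "inj_on h (fst ?Q)"
        using h_s[OF h(2)] by (auto intro!: inj_onI simp: Q_simps)
      ultimately show ?thesis by (simp add: sys_embs_def inj_on_restrict_eq)
    qed
    then show "(\<lambda>h. restrict h (fst ?Q)) ` {h \<in> sys_homs Z T. kernel_rep ?C h = s} \<subseteq> sys_embs ?Q T"
      by auto
    show "\<forall>g\<in>sys_embs ?Q T. restrict (restrict (g \<circ> s) ?C) (fst ?Q) = g"
    proof
      fix g assume "g \<in> sys_embs ?Q T"
      then have "restrict g (fst ?Q) = g" unfolding sys_embs_def by (blast intro: restrict_sys_homs_id)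
      moreover have "restrict (restrict (g \<circ> s) ?C) (fst ?Q) = restrict g (fst ?Q)"
        using s by (intro restrict_ext) (auto simp: Q_simps)
      ultimately show "restrict (restrict (g \<circ> s) ?C) (fst ?Q) = g" by simp
    qed
    show "\<forall>h\<in>{h \<in> sys_homs Z T. kernel_rep ?C h = s}. restrict (restrict h (fst ?Q) \<circ> s) ?C = h"
    proof
      fix h assume "h \<in> {h \<in> sys_homs Z T. kernel_rep ?C h = s}"
      then have h: "h \<in> sys_homs Z T" "kernel_rep ?C h = s" by auto
      have "restrict (restrict h (fst ?Q) \<circ> s) ?C = restrict h ?C"
        using h_s(1)[OF h(2)] by (intro restrict_ext) (auto simp: Q_simps)
      then show "restrict (restrict h (fst ?Q) \<circ> s) ?C = h" using restrict_sys_homs_id[OF h(1)] by simp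
    qed
  qed
  then show ?thesis by (simp add: bij_betw_same_card)
qed

text \<open>Homomorphisms are sorted by their kernels.\<close>

lemma card_sys_homs_eq_sum_embs:
  assumes "is_fdds Z" "is_fdds T"
  shows "card (sys_homs Z T) = (\<Sum>s\<in>sys_congruences Z. card (sys_embs (sys_quotient Z s) T))"
proof -
  have "card (sys_homs Z T) = (\<Sum>h\<in>sys_homs Z T. 1)" by simp
  also have "\<dots> = (\<Sum>s\<in>sys_congruences Z. \<Sum>h | h \<in> sys_homs Z T \<and> kernel_rep (fst Z) h = s. 1)"
    using assms by (intro sum.group[symmetric] finite_sys_homs finite_sys_congruences)
      (auto intro: kernel_rep_sys_homs)
  also have "\<dots> = (\<Sum>s\<in>sys_congruences Z. card (sys_embs (sys_quotient Z s) T))"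
    using card_sys_homs_kernel[OF assms(1)] by (intro sum.cong) simp_all
  finally show ?thesis .
qed

text \<open>Inverts \<open>card_sys_homs_eq_sum_embs\<close>: the identity congruence contributes
  the embeddings of \<open>Z\<close>, and all other congruences contribute embeddings of strictly
  smaller systems, which agree by induction.\<close>

lemma card_sys_embs_eq:
  fixes S T :: "'a sys"
  assumes "is_fdds S" "is_fdds T"
    and homs: "\<And>Z :: nat sys. is_fdds Z \<Longrightarrow> card (sys_homs Z S) = card (sys_homs Z T)"
  shows "is_fdds (Z :: nat sys) \<Longrightarrow> card (sys_embs Z S) = card (sys_embs Z T)"
proof (induction "card (fst Z)" arbitrary: Z rule: less_induct)
  case less
  let ?C = "fst Z" and ?i = "restrict (\<lambda>x. x) (fst Z)"
  have i: "?i \<in> sys_congruences Z"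
  proof -
    have "kernel_rep ?C ?i = ?i"
      unfolding kernel_rep_def by (rule restrict_ext) (auto intro: Least_equality)
    then show ?thesis using less.prems by (simp add: sys_congruences_def)
  qed
  \<comment> \<open>The quotient by the identity may differ from \<open>Z\<close> in the values of
    its map outside the carrier; homomorphisms do not see these.\<close>
  have quot_i: "sys_embs (sys_quotient Z ?i) U = sys_embs Z U" for U :: "'a sys"
    using less.prems by (auto simp: sys_embs_def sys_homs_def sys_quotient_def is_fdds_def)
  have fin: "finite ?C" using less.prems by (simp add: is_fdds_def)
  have "card (sys_embs (sys_quotient Z s) S) = card (sys_embs (sys_quotient Z s) T)"
    if s: "s \<in> sys_congruences Z - {?i}" for s
  proof (rule less.hyps)
    have s': "s \<in> sys_congruences Z" using s by simp
    then show "is_fdds (sys_quotient Z s)" using less.prems by (rule_tac is_fdds_sys_quotient)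
    \<comment> \<open>Since \<open>s (s x) = s x\<close>, injectivity would force \<open>s\<close>
      to fix every state.\<close>
    have "\<not> inj_on s ?C"
    proof
      assume "inj_on s ?C"
      then have "s x = x" if "x \<in> ?C" for x
        using sys_congruencesD[OF s' that] that by (auto dest: inj_onD)
      moreover have "s = restrict s ?C"
        using s' by (metis (mono_tags, lifting) kernel_rep_def mem_Collect_eq restrict_restrict
            inf.idem sys_congruences_def)
      ultimately have "s = ?i" by (metis restrict_ext)
      with s show False by simp
    qed
    then have "card (s ` ?C) < card ?C"
      using fin card_image_le[OF fin, of s] inj_on_iff_eq_card[OF fin, of s] by simp
    then show "card (fst (sys_quotient Z s)) < card ?C" by (simp add: sys_quotient_def)
  qed
  then have "(\<Sum>s\<in>sys_congruences Z - {?i}. card (sys_embs (sys_quotient Z s) S))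
      = (\<Sum>s\<in>sys_congruences Z - {?i}. card (sys_embs (sys_quotient Z s) T))"
    by (rule sum.cong[OF refl])
  moreover have "card (sys_homs Z U) = card (sys_embs Z U)
      + (\<Sum>s\<in>sys_congruences Z - {?i}. card (sys_embs (sys_quotient Z s) U))"
    if "is_fdds U" for U :: "'a sys"
    using card_sys_homs_eq_sum_embs[OF less.prems that]
      sum.remove[OF finite_sys_congruences[OF less.prems] i,
        of "\<lambda>s. card (sys_embs (sys_quotient Z s) U)"] quot_i[of U] by simp
  ultimately show ?case using homs[OF less.prems] assms(1,2) by simp
qed

text \<open>Take \<open>Z = S\<close> and \<open>Z = T\<close>: the identity is an embedding of each
  system into itself, so each embeds into the other. The finite carriers then have equal size, and
  an embedding is an isomorphism.\<close>

lemma sys_iso_if_card_sys_homs_eq: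
  fixes S T :: "nat sys"
  assumes "is_fdds S" "is_fdds T"
    and "\<And>Z :: nat sys. is_fdds Z \<Longrightarrow> sys_connected Z \<Longrightarrow>
      card (sys_homs Z S) = card (sys_homs Z T)"
  shows "sys_iso S T"
proof -
  have embs: "card (sys_embs Z S) = card (sys_embs Z T)" if "is_fdds Z" for Z :: "nat sys"
    using assms(1,2) card_sys_homs_eq_if_connected[OF assms(3)] that by (rule card_sys_embs_eq)
  have fin: "finite (sys_embs Z U)" if "is_fdds Z" "is_fdds U" for Z U :: "nat sys"
    using finite_sys_homs[OF that] by (simp add: sys_embs_def)
  have "restrict (\<lambda>x. x) (fst U) \<in> sys_embs U U" if "is_fdds U" for U :: "nat sys"
    using that by (auto simp: sys_embs_def inj_on_def intro!: restrict_sys_homs)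
  then have "sys_embs S S \<noteq> {}" "sys_embs T T \<noteq> {}" using assms(1,2) by blast+
  then have "sys_embs S T \<noteq> {}" "sys_embs T S \<noteq> {}"
    using embs[OF assms(1)] embs[OF assms(2)] fin assms(1,2) by (metis card_0_eq)+
  then obtain h k where hk: "h \<in> sys_embs S T" "k \<in> sys_embs T S" by blast
  have fin': "finite (fst S)" "finite (fst T)" using assms(1,2) by (auto simp: is_fdds_def)
  have h: "inj_on h (fst S)" "h ` fst S \<subseteq> fst T" and k: "inj_on k (fst T)" "k ` fst T \<subseteq> fst S"
    using hk by (auto simp: sys_embs_def sys_homs_in)
  have "card (fst S) = card (fst T)"
    using card_inj_on_le[OF h fin'(2)] card_inj_on_le[OF k fin'(1)] by simp
  then have "h ` fst S = fst T" using card_image[OF h(1)] h(2) fin' by (metis card_subset_eq)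
  then show ?thesis
    using h(1) hk(1) by (intro sys_isoI[of h]) (auto simp: bij_betw_def sys_embs_def sys_homs_eq)
qed

section \<open>Cycles\<close>

text \<open>A permutation with at most one orbit; the empty system qualifies.\<close>

definition sys_cycle :: "'a sys \<Rightarrow> bool" where
  "sys_cycle S \<longleftrightarrow> is_fdds S \<and> inj_on (snd S) (fst S) \<and>
     (\<forall>a\<in>fst S. \<forall>b\<in>fst S. \<exists>n. (snd S ^^ n) a = b)"

text \<open>The value at one state \<open>z\<close> determines a homomorphism: agreement passes
  forward along arcs always, and backward because the cycle map is injective. Every value occurs, by
  rotating a given homomorphism.\<close>

lemma card_sys_homs_cycle:
  assumes "is_fdds Z" "sys_connected Z" "sys_cycle S" "sys_homs Z S \<noteq> {}"
  shows "card (sys_homs Z S) = card (fst S)"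
proof -
  obtain z where z: "z \<in> fst Z" using assms(2) by (auto simp: sys_connected_def)
  obtain h where h: "h \<in> sys_homs Z S" using assms(4) by blast
  have S: "is_fdds S" "inj_on (snd S) (fst S)"
    "\<And>a b. a \<in> fst S \<Longrightarrow> b \<in> fst S \<Longrightarrow> \<exists>n. (snd S ^^ n) a = b"
    using assms(3) by (auto simp: sys_cycle_def)
  have "bij_betw (\<lambda>h. h z) (sys_homs Z S) (fst S)"
  proof (rule bij_betw_imageI)
    show "inj_on (\<lambda>h. h z) (sys_homs Z S)"
    proof (intro inj_onI sys_homs_ext)
      fix h k x assume hk: "h \<in> sys_homs Z S" "k \<in> sys_homs Z S" "h z = k z" and x: "x \<in> fst Z"
      show "h x = k x"
      proof (rule sys_connected_invariant[OF assms(2) z x])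
        fix y assume "y \<in> fst Z"
        then show "h (snd Z y) = k (snd Z y) \<longleftrightarrow> h y = k y"
          using hk S(2) by (simp add: sys_homs_eq sys_homs_in inj_on_eq_iff)
      qed (rule hk(3))
    qed
    show "(\<lambda>h. h z) ` sys_homs Z S = fst S"
    proof (intro equalityI subsetI)
      fix b assume "b \<in> fst S"
      then obtain n where n: "(snd S ^^ n) (h z) = b" using S(3) sys_homs_in[OF h z] by blast
      \<comment> \<open>The rotation: an iterate of \<open>snd S\<close> commutes with
        \<open>snd S\<close>, so composing with it preserves homomorphisms.\<close>
      have "restrict (\<lambda>x. (snd S ^^ n) (h x)) (fst Z) \<in> sys_homs Z S"
        using funpow_iso[OF S(1), of "\<lambda>x. x" S _ n] assms(1) h
        by (intro restrict_sys_homs) (auto simp: sys_homs_in sys_homs_eq funpow_swap1)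
      then show "b \<in> (\<lambda>h. h z) ` sys_homs Z S"
        by (rule rev_image_eqI) (use n z in simp)
    qed (auto simp: z sys_homs_in[OF _ z])
  qed
  then show ?thesis by (rule bij_betw_same_card)
qed

text \<open>The pigeonhole principle is applied to the iterates as functions on the whole carrier,
  so that one pair \<open>n\<close>, \<open>p\<close> serves all states.\<close>

lemma funpow_eventually_periodic:
  assumes "is_fdds S"
  obtains n p where "p > 0" "\<And>x. x \<in> fst S \<Longrightarrow> (snd S ^^ p) ((snd S ^^ n) x) = (snd S ^^ n) x"
proof -
  let ?F = "\<lambda>n. restrict (snd S ^^ n) (fst S)"
  have "(snd S ^^ n) x \<in> fst S" if "x \<in> fst S" for n x
    using funpow_iso[OF assms, of "\<lambda>x. x" S] that by auto
  then have "range ?F \<subseteq> fst S \<rightarrow>\<^sub>E fst S" by auto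
  then have "finite (range ?F)"
    by (rule finite_subset) (use assms in \<open>simp add: is_fdds_def finite_PiE\<close>)
  then have "\<not> inj ?F" using finite_imageD infinite_UNIV_nat by blast
  then obtain i j where ij: "i \<noteq> j" "?F i = ?F j" by (auto simp: inj_def)
  define n where "n = min i j"
  define p where "p = max i j - min i j"
  have "?F (p + n) = ?F n" using ij by (auto simp: n_def p_def min_def max_def)
  then have "(snd S ^^ p) ((snd S ^^ n) x) = (snd S ^^ n) x" if "x \<in> fst S" for x
    using that by (metis comp_apply funpow_add restrict_apply')
  moreover have "p > 0" using ij(1) by (auto simp: p_def)
  ultimately show thesis using that by blast
qed

text \<open>For a cyclic state \<open>a\<close> this is the cycle through \<open>a\<close>.\<close>

definition sys_orbit :: "'a sys \<Rightarrow> 'a \<Rightarrow> 'a sys" where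
  "sys_orbit S a = (range (\<lambda>n. (snd S ^^ n) a), snd S)"

lemma fst_sys_orbit_subset:
  assumes "is_fdds S" "a \<in> fst S"
  shows "fst (sys_orbit S a) \<subseteq> fst S"
  using funpow_iso[OF assms(1), of "\<lambda>x. x" S a] assms(2) by (auto simp: sys_orbit_def)

lemma sys_cycle_orbit:
  assumes "is_fdds S" "a \<in> cyclic_states S"
  shows "sys_cycle (sys_orbit S a)"
proof -
  let ?f = "snd S" and ?O = "range (\<lambda>n. (snd S ^^ n) a)"
  obtain p where p: "p > 0" "(?f ^^ p) a = a" and a: "a \<in> fst S"
    using assms(2) by (auto simp: cyclic_states_def)
  have period: "(?f ^^ p) ((?f ^^ n) a) = (?f ^^ n) a" for n
    using p(2) by (metis comp_apply funpow_add add.commute)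
  \<comment> \<open>One step followed by \<open>p - 1\<close> more completes a period, so
    \<open>?f\<close> has a left inverse on the orbit.\<close>
  have inv: "(?f ^^ (p - 1)) (?f b) = b" if "b \<in> ?O" for b
    using that period p(1) by (metis (no_types, lifting) Suc_diff_1 comp_apply funpow_Suc_right rangeE)
  have closed: "?f b \<in> ?O" if "b \<in> ?O" for b
  proof -
    obtain n where "b = (?f ^^ n) a" using \<open>b \<in> ?O\<close> by blast
    then have "?f b = (?f ^^ Suc n) a" by simp
    then show ?thesis by blast
  qed
  have "finite ?O"
    using fst_sys_orbit_subset[OF assms(1) a] assms(1)
    by (auto simp: sys_orbit_def is_fdds_def intro: finite_subset)
  moreover have "inj_on ?f ?O" by (rule inj_on_inverseI) (rule inv)
  moreover have "\<exists>k. (?f ^^ k) b = c" if "b \<in> ?O" "c \<in> ?O" for b c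
  proof -
    obtain m n where mn: "b = (?f ^^ m) a" "c = (?f ^^ n) a" using \<open>b \<in> ?O\<close> \<open>c \<in> ?O\<close> by blast
    have "((?f ^^ p) ^^ m) a = a" by (induction m) (simp_all add: p(2))
    then have "(?f ^^ (p * m)) a = a" by (simp add: funpow_mult mult.commute)
    \<comment> \<open>From \<open>b\<close>, the \<open>m\<close>-th iterate of \<open>a\<close>, a
      further \<open>p * m - m\<close> steps lead back to \<open>a\<close>; then \<open>n\<close>
      steps lead to \<open>c\<close>.\<close>
    moreover have "p * m = (p * m - m) + m" using p(1) by (cases p) auto
    ultimately have "(?f ^^ (p * m - m)) b = a" using mn(1) by (metis comp_apply funpow_add)
    then have "(?f ^^ (n + (p * m - m))) b = c" using mn(2) by (simp add: funpow_add)
    then show ?thesis ..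
  qed
  ultimately show ?thesis
    using closed by (simp add: sys_cycle_def sys_orbit_def is_fdds_def)
qed

text \<open>Following a homomorphism by enough steps of the dynamics moves all its values onto
  cycles; connectivity of \<open>Z\<close> then keeps them on a single cycle.\<close>

lemma sys_homs_to_orbit:
  assumes "is_fdds Z" "sys_connected Z" "is_fdds S" "sys_homs Z S \<noteq> {}"
  obtains a where "a \<in> cyclic_states S" "sys_homs Z (sys_orbit S a) \<noteq> {}"
proof -
  obtain z where z: "z \<in> fst Z" using assms(2) by (auto simp: sys_connected_def)
  obtain h where h: "h \<in> sys_homs Z S" using assms(4) by blast
  let ?f = "snd S"
  obtain n p where p: "p > 0" "\<And>x. x \<in> fst S \<Longrightarrow> (?f ^^ p) ((?f ^^ n) x) = (?f ^^ n) x"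
    using funpow_eventually_periodic[OF assms(3)] by blast
  define g where "g x = (?f ^^ n) (h x)" for x
  have g: "g x \<in> fst S" "(?f ^^ p) (g x) = g x" "g (snd Z x) = ?f (g x)" if "x \<in> fst Z" for x
    using funpow_iso[OF assms(3), of "\<lambda>x. x" S "h x" n] p(2) that h
    by (auto simp: g_def sys_homs_in sys_homs_eq funpow_swap1)
  let ?O = "range (\<lambda>n. (?f ^^ n) (g z))"
  have orbit: "g x \<in> ?O" if "x \<in> fst Z" for x
  proof (rule sys_connected_invariant[OF assms(2) z that])
    show "g z \<in> ?O" by (rule range_eqI[of _ _ 0]) simp
    fix y assume y: "y \<in> fst Z"
    have step: "(?f ^^ k) b \<in> ?O" if "b \<in> ?O" for b k
      using that by (auto simp: image_iff) (metis comp_apply funpow_add)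
    \<comment> \<open>Values of \<open>g\<close> have period \<open>p\<close>, so a step can be
      undone inside the orbit; this gives the backward half of the invariance.\<close>
    have "(?f ^^ (p - 1)) (?f (g y)) = g y"
      using g(2)[OF y] p(1) by (metis Suc_diff_1 comp_apply funpow_Suc_right)
    then show "g (snd Z y) \<in> ?O \<longleftrightarrow> g y \<in> ?O"
      using step[of "?f (g y)" "p - 1"] step[of "g y" 1] g(3)[OF y] by auto
  qed
  have "restrict g (fst Z) \<in> sys_homs Z (sys_orbit S (g z))"
    using assms(1) orbit g(3) by (intro restrict_sys_homs) (auto simp: sys_orbit_def)
  moreover have "g z \<in> cyclic_states S"
    using g[OF z] p(1) by (auto simp: cyclic_states_def)
  ultimately show thesis using that by blast
qed

section \<open>Homomorphism counts on isomorphism classes\<close>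

text \<open>The value 0 is a default for a \<open>Z\<close> that is not an FDDS: invariance under
  isomorphism of the target comes from \<open>card_sys_homs_iso\<close>, which assumes
  \<open>is_fdds Z\<close>.\<close>

lift_definition hom_count :: "nat sys \<Rightarrow> fdds \<Rightarrow> nat" is
  "\<lambda>Z S. if is_fdds Z then card (sys_homs Z S) else 0"
  by (simp add: fdds_rel_def card_sys_homs_iso)

lift_definition has_fixed_point :: "fdds \<Rightarrow> bool" is "\<lambda>S. \<exists>x\<in>fst S. snd S x = x"
proof -
  have "\<exists>x\<in>fst T. snd T x = x" if "fdds_rel S T" "\<exists>x\<in>fst S. snd S x = x" for S T
    using that by (metis bij_betwE fdds_rel_def sys_iso_def)
  then show "(\<exists>x\<in>fst S. snd S x = x) \<longleftrightarrow> (\<exists>x\<in>fst T. snd T x = x)" if "fdds_rel S T" for S T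
    using that fdds_rel_sym by metis
qed

lemma fdds_representative:
  obtains T where "is_fdds T" "S = abs_fdds T"
proof
  show "is_fdds (rep_fdds S)"
    using Quotient3_rep_reflp[OF Quotient3_fdds, of S] by (simp add: fdds_rel_def)
  show "S = abs_fdds (rep_fdds S)"
    using Quotient3_abs_rep[OF Quotient3_fdds, of S] by simp
qed

lemma hom_count_abs:
  assumes "is_fdds Z" "is_fdds S"
  shows "hom_count Z (abs_fdds S) = card (sys_homs Z S)"
  using assms hom_count.abs_eq[of S Z] by (simp add: fdds_rel_def)

lemma has_fixed_point_abs:
  assumes "is_fdds S"
  shows "has_fixed_point (abs_fdds S) \<longleftrightarrow> (\<exists>x\<in>fst S. snd S x = x)"
  using assms has_fixed_point.abs_eq[of S] by (simp add: fdds_rel_def)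

lemma contains_dendron_iff: "(\<exists>D. dendron D \<and> contains S D) \<longleftrightarrow> has_fixed_point S"
proof transfer
  fix S :: "nat sys" assume "fdds_rel S S"
  then have S: "is_fdds S" by (simp add: fdds_rel_def)
  show "(\<exists>D\<in>{D. fdds_rel D D}. sys_dendron D \<and> sys_contains S D) \<longleftrightarrow> (\<exists>x\<in>fst S. snd S x = x)"
    using contains_dendron_iff_fixed_point[OF S] by (auto simp: fdds_rel_def)
qed

section \<open>Counting from a connected system as a semiring homomorphism\<close>

context
  fixes Z :: "nat sys"
  assumes Z: "is_fdds Z" "sys_connected Z"
begin

lemma hom_count_zero: "hom_count Z 0 = 0"
  using Z by transfer (auto simp: sys_homs_def sys_connected_def)

lemma hom_count_one: "hom_count Z 1 = 1"
proof -
  have "sys_homs Z ({0 :: nat}, id) = {restrict (\<lambda>_. 0) (fst Z)}"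
  proof (intro equalityI subsetI)
    fix h assume h: "h \<in> sys_homs Z ({0 :: nat}, id)"
    then have "restrict h (fst Z) = restrict (\<lambda>_. 0) (fst Z)"
      using sys_homs_in[OF h] by (intro restrict_ext) simp
    then show "h \<in> {restrict (\<lambda>_. 0) (fst Z)}" using restrict_sys_homs_id[OF h] by simp
  qed (use Z(1) in \<open>auto intro!: restrict_sys_homs\<close>)
  then show ?thesis
    using hom_count_abs[OF Z(1), of "({0}, id)"] by (simp add: one_fdds.abs_eq is_fdds_def)
qed

lemma hom_count_add: "hom_count Z (S + T) = hom_count Z S + hom_count Z T"
proof -
  obtain S' T' where S': "is_fdds S'" "S = abs_fdds S'" and T': "is_fdds T'" "T = abs_fdds T'"
    by (metis fdds_representative)
  have "S + T = abs_fdds (nat_sum S' T')"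
    using S' T' by (simp add: plus_fdds.abs_eq fdds_rel_def)
  moreover have "card (sys_homs Z (nat_sum S' T')) = card (sys_homs Z (sys_sum S' T'))"
    using Z S' T' by (intro card_sys_homs_iso is_fdds_nat_sum is_fdds_sum nat_sum')
  ultimately show ?thesis
    using Z S' T' by (simp add: hom_count_abs is_fdds_nat_sum card_sys_homs_sum)
qed

lemma hom_count_mult: "hom_count Z (S * T) = hom_count Z S * hom_count Z T"
proof -
  obtain S' T' where S': "is_fdds S'" "S = abs_fdds S'" and T': "is_fdds T'" "T = abs_fdds T'"
    by (metis fdds_representative)
  have "S * T = abs_fdds (nat_prod S' T')"
    using S' T' by (simp add: times_fdds.abs_eq fdds_rel_def)
  moreover have "card (sys_homs Z (nat_prod S' T')) = card (sys_homs Z (sys_prod S' T'))"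
    using Z S' T' by (intro card_sys_homs_iso is_fdds_nat_prod is_fdds_prod nat_prod')
  ultimately show ?thesis
    using Z S' T' by (simp add: hom_count_abs is_fdds_nat_prod card_sys_homs_prod)
qed

lemma hom_count_power: "hom_count Z (S ^ n) = hom_count Z S ^ n"
  by (induction n) (simp_all add: hom_count_one hom_count_mult)

lemma hom_count_of_nat: "hom_count Z (of_nat n) = n"
  by (induction n) (simp_all add: hom_count_zero hom_count_one hom_count_add)

lemma hom_count_sum: "hom_count Z (\<Sum>i\<in>I. F i) = (\<Sum>i\<in>I. hom_count Z (F i))"
  by (induction I rule: infinite_finite_induct) (simp_all add: hom_count_zero hom_count_add)

text \<open>The constant map onto a fixed point is a homomorphism.\<close>

lemma hom_count_pos:
  assumes "has_fixed_point S"
  shows "hom_count Z S > 0"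
proof -
  obtain T where T: "is_fdds T" "S = abs_fdds T" by (rule fdds_representative)
  then obtain x where x: "x \<in> fst T" "snd T x = x" using assms has_fixed_point_abs by blast
  have "restrict (\<lambda>_. x) (fst Z) \<in> sys_homs Z T" using Z(1) x by (intro restrict_sys_homs) auto
  then show ?thesis
    using T finite_sys_homs[OF Z(1) T(1)] Z by (auto simp: hom_count_abs card_gt_0_iff)
qed

end

lemma fdds_eqI:
  assumes "\<And>Z. is_fdds Z \<Longrightarrow> sys_connected Z \<Longrightarrow> hom_count Z S = hom_count Z T"
  shows "S = T"
proof -
  obtain S' T' where S': "is_fdds S'" "S = abs_fdds S'" and T': "is_fdds T'" "T = abs_fdds T'"
    by (metis fdds_representative)
  then have "sys_iso S' T'"
    using assms by (intro sys_iso_if_card_sys_homs_eq) (simp_all add: hom_count_abs)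
  then have "fdds_rel S' T'" using S'(1) T'(1) by (simp add: fdds_rel_def)
  then show ?thesis unfolding S'(2) T'(2) by (rule Quotient3_rel_abs[OF Quotient3_fdds])
qed

section \<open>Injectivity of polynomials\<close>

lemma inj_if_has_fixed_point:
  assumes "i \<in> {1..m}" "has_fixed_point (A i)"
  shows "inj (\<lambda>X. \<Sum>i\<le>m. A i * X ^ i)"
proof (intro injI fdds_eqI)
  fix X Y and Z :: "nat sys" assume eq: "(\<Sum>i\<le>m. A i * X ^ i) = (\<Sum>i\<le>m. A i * Y ^ i)"
    and Z: "is_fdds Z" "sys_connected Z"
  \<comment> \<open>Counting from \<open>Z\<close> turns the polynomial into one with natural number
    coefficients, evaluated at \<open>hom_count Z X\<close>.\<close>
  let ?p = "\<lambda>x. \<Sum>i\<le>m. hom_count Z (A i) * x ^ i"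
  have "hom_count Z (\<Sum>i\<le>m. A i * X ^ i) = ?p (hom_count Z X)" for X
    using Z by (simp add: hom_count_sum hom_count_mult hom_count_power)
  with eq have "?p (hom_count Z X) = ?p (hom_count Z Y)" by metis
  moreover have "?p x < ?p y" if "x < y" for x y
  proof (rule sum_strict_mono_ex1)
    show "\<forall>j\<in>{..m}. hom_count Z (A j) * x ^ j \<le> hom_count Z (A j) * y ^ j"
      using that by (simp add: power_mono)
    \<comment> \<open>The term \<open>i\<close> is strictly increasing because its coefficient is
      positive and \<open>i > 0\<close>.\<close>
    have "hom_count Z (A i) * x ^ i < hom_count Z (A i) * y ^ i"
      using hom_count_pos[OF Z assms(2)] that assms(1) by (simp add: power_strict_mono)
    then show "\<exists>j\<in>{..m}. hom_count Z (A j) * x ^ j < hom_count Z (A j) * y ^ j"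
      using assms(1) by auto
  qed simp
  ultimately show "hom_count Z X = hom_count Z Y"
    by (metis less_irrefl linorder_neqE_nat)
qed

text \<open>FDDSs have no subtraction, so a formal difference is kept as a pair \<open>X\<close>,
  \<open>Y\<close>. One pair serves all connected \<open>Z\<close> at once.\<close>

lemma exists_formal_product:
  assumes "finite F"
  shows "\<exists>X Y. \<forall>Z. is_fdds Z \<longrightarrow> sys_connected Z \<longrightarrow>
    int (hom_count Z X) - int (hom_count Z Y) = (\<Prod>a\<in>F. int (c a) - int (hom_count Z (S a)))"
  using assms
proof induction
  case empty
  \<comment> \<open>The empty product is the formal difference \<open>1 - 0\<close>.\<close>
  have "int (hom_count Z 1) - int (hom_count Z 0) = 1" if "is_fdds Z" "sys_connected Z" for Z
    using that by (simp add: hom_count_zero hom_count_one)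
  then show ?case by (metis prod.empty)
next
  case (insert a F)
  then obtain X Y where XY: "\<And>Z. is_fdds Z \<Longrightarrow> sys_connected Z \<Longrightarrow>
      int (hom_count Z X) - int (hom_count Z Y) = (\<Prod>a\<in>F. int (c a) - int (hom_count Z (S a)))"
    by metis
  show ?case
  \<comment> \<open>The witnesses come from expanding
    \<open>(c - S) * (X - Y) = (c * X + S * Y) - (c * Y + S * X)\<close>, where the number
    \<open>c\<close> stands for \<open>c\<close> isolated fixed points.\<close>
  proof (rule exI[of _ "of_nat (c a) * X + S a * Y"], rule exI[of _ "of_nat (c a) * Y + S a * X"],
      intro allI impI)
    fix Z :: "nat sys" assume Z: "is_fdds Z" "sys_connected Z"
    show "int (hom_count Z (of_nat (c a) * X + S a * Y)) - int (hom_count Z (of_nat (c a) * Y + S a * X))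
      = (\<Prod>a\<in>insert a F. int (c a) - int (hom_count Z (S a)))"
      unfolding prod.insert[OF insert.hyps] XY[OF Z, symmetric] using Z
      by (simp add: hom_count_add hom_count_mult hom_count_of_nat algebra_simps)
  qed
qed

text \<open>By contradiction: injectivity forces the two halves of the formal product to be equal,
  while their numbers of fixed points differ.\<close>

lemma has_fixed_point_if_inj:
  assumes "inj (\<lambda>X. \<Sum>i\<le>m. A i * X ^ i)"
  shows "\<exists>i\<in>{1..m}. has_fixed_point (A i)"
proof (rule ccontr)
  assume no_fix: "\<not> ?thesis"
  have "\<exists>T. is_fdds T \<and> A i = abs_fdds T" for i
    using fdds_representative[of "A i"] by blast
  then obtain R where R: "\<And>i. is_fdds (R i)" "\<And>i. A i = abs_fdds (R i)" by metis
  \<comment> \<open>Indexing by cyclic states lists each cycle once per state. The repeated factors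
    are harmless, since only the vanishing of the product matters. Index 0 is left out, as
    \<open>A 0\<close> may have fixed points.\<close>
  define F where "F = (SIGMA i:{1..m}. cyclic_states (R i))"
  define cyc where "cyc = (\<lambda>(i, a). sys_orbit (R i) a)"
  have fin: "finite F"
    using R(1) by (auto simp: F_def cyclic_states_def is_fdds_def)
  have cyc: "sys_cycle (cyc u)" if "u \<in> F" for u
    using that R(1) sys_cycle_orbit unfolding F_def cyc_def by fast
  then have cyc_fdds: "is_fdds (cyc u)" if "u \<in> F" for u
    using that by (auto simp: sys_cycle_def)
  obtain X Y where XY: "\<And>Z. is_fdds Z \<Longrightarrow> sys_connected Z \<Longrightarrow>
      int (hom_count Z X) - int (hom_count Z Y)
        = (\<Prod>u\<in>F. int (card (fst (cyc u))) - int (hom_count Z (abs_fdds (cyc u))))"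
    using exists_formal_product[OF fin, of "\<lambda>u. card (fst (cyc u))" "\<lambda>u. abs_fdds (cyc u)"] by blast
  have "(\<Sum>i\<le>m. A i * X ^ i) = (\<Sum>i\<le>m. A i * Y ^ i)"
  proof (intro fdds_eqI)
    fix Z :: "nat sys" assume Z: "is_fdds Z" "sys_connected Z"
    have "hom_count Z (A i) * hom_count Z X ^ i = hom_count Z (A i) * hom_count Z Y ^ i"
      if i: "i \<le> m" for i
    \<comment> \<open>For \<open>i = 0\<close> both powers are 1, and for a zero coefficient both
      products are 0. In the remaining case \<open>Z\<close> maps to a cycle of \<open>R i\<close>,
      which makes one factor of the product vanish.\<close>
    proof (cases "i = 0 \<or> hom_count Z (A i) = 0")
      case False
      then have "sys_homs Z (R i) \<noteq> {}"
        using R hom_count_abs[OF Z(1) R(1)[of i]] by (metis card.empty)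
      then obtain a where a: "a \<in> cyclic_states (R i)" "sys_homs Z (cyc (i, a)) \<noteq> {}"
        using sys_homs_to_orbit[OF Z R(1)[of i]] unfolding cyc_def prod.case by blast
      then have u: "(i, a) \<in> F" using False i by (auto simp: F_def)
      have "hom_count Z (abs_fdds (cyc (i, a))) = card (fst (cyc (i, a)))"
        using hom_count_abs[OF Z(1) cyc_fdds[OF u]] card_sys_homs_cycle[OF Z cyc[OF u] a(2)] by simp
      then have "(\<Prod>u\<in>F. int (card (fst (cyc u))) - int (hom_count Z (abs_fdds (cyc u)))) = 0"
        using u fin by (intro prod_zero bexI[of _ "(i, a)"]) auto
      then have "hom_count Z X = hom_count Z Y" using XY[OF Z] by simp
      then show ?thesis by simp
    qed auto
    then have "(\<Sum>i\<le>m. hom_count Z (A i) * hom_count Z X ^ i)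
        = (\<Sum>i\<le>m. hom_count Z (A i) * hom_count Z Y ^ i)"
      by (intro sum.cong) simp_all
    then show "hom_count Z (\<Sum>i\<le>m. A i * X ^ i) = hom_count Z (\<Sum>i\<le>m. A i * Y ^ i)"
      using Z by (simp add: hom_count_sum hom_count_mult hom_count_power)
  qed
  with assms have "X = Y" by (rule injD)
  \<comment> \<open>Homomorphisms from a single fixed point correspond to the fixed points of the
    target. The cycles in \<open>F\<close> have none, so each factor becomes the positive number
    \<open>card (fst (cyc u))\<close>.\<close>
  let ?I = "({0}, id) :: nat sys"
  have I: "is_fdds ?I" "sys_connected ?I"
    by (auto simp: is_fdds_def sys_connected_def weakly_connected_rel_def)
  have "int (card (fst (cyc u))) - int (hom_count ?I (abs_fdds (cyc u))) \<noteq> 0" if u: "u \<in> F" for u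
  proof -
    obtain i a where ia: "u = (i, a)" "i \<in> {1..m}" "a \<in> fst (R i)"
      using u by (auto simp: F_def cyclic_states_def)
    have "\<not> has_fixed_point (abs_fdds (R i))" using no_fix ia(2) R(2) by metis
    then have "snd (R i) x \<noteq> x" if "x \<in> fst (R i)" for x
      using that has_fixed_point_abs[OF R(1)] by blast
    then have "snd (cyc u) x \<noteq> x" if "x \<in> fst (cyc u)" for x
      using that fst_sys_orbit_subset[OF R(1) ia(3)] by (auto simp: ia(1) cyc_def sys_orbit_def)
    then have "sys_homs ?I (cyc u) = {}" by (fastforce simp: sys_homs_def)
    then have "hom_count ?I (abs_fdds (cyc u)) = 0"
      using hom_count_abs[OF I(1) cyc_fdds[OF u]] by simp
    moreover have "fst (cyc u) \<noteq> {}" by (auto simp: ia(1) cyc_def sys_orbit_def)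
    then have "card (fst (cyc u)) > 0" using cyc_fdds[OF u] by (auto simp: is_fdds_def card_gt_0_iff)
    ultimately show ?thesis by simp
  qed
  then have "int (hom_count ?I X) - int (hom_count ?I Y) \<noteq> 0"
    using XY[OF I] fin by (simp add: prod_zero_iff)
  with \<open>X = Y\<close> show False by simp
qed

theorem theorem42:
  fixes A :: "nat \<Rightarrow> fdds" and m :: nat
  shows "inj (\<lambda>X. \<Sum>i\<le>m. A i * X ^ i) \<longleftrightarrow>
    (\<exists>i\<in>{1..m}. \<exists>D. dendron D \<and> contains (A i) D)"
  unfolding contains_dendron_iff using inj_if_has_fixed_point has_fixed_point_if_inj by blast

end
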